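(* Let $B=\{B(x),x\in[0,1]\}$ be a Brownian motion and consider, for almost every path of $B$, the bilinear form $$\mathcal E(f,g):=\int_0^1 f'(x)g'(x)\,dx-\int_0^1\bigl(f'(x)g(x)+f(x)g'(x)\bigr)B(x)\,dx,\qquad f,g\in H_1.$$ Let $\tilde L$, with domain $\mathcal D\subset H_1$, be the operator associated with $\mathcal E$: $\mathcal D$ consists of those $f\in H_1$ that admit a function $g\in H_1$ such that $\mathcal E(f,h)=\int_0^1 g(x)h(x)\,dx$ for all $h\in H_1$, and $\tilde Lf=g$. Let $T$ be the stochastic Green operator $$[Tf](x):=\frac1\alpha\int_0^1 G(x,y)f(y)\,dy,\quad f\in H_1,\qquad G(x,y):=\begin{cases}u(y)v(x), & 0\le y\le x\le 1,\\ u(x)v(y), & 0\le x\le y\le 1,\end{cases}$$ where $H_1$, $u$, $v$ and $\alpha$ are as defined in the context. Then (almost surely) the domain $\mathcal D$ of $\tilde L$ is given by $T(H_1)$.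
   Context: All spaces are over $\mathbb R$. $H:=\{h\in L_2[0,1]: h(0)=h(1)=0\}$ and $H_1:=\{h\in H: h\text{ is absolutely continuous}\}$. $B$ is a Brownian motion supported by a filtered probability space $(\Omega,\mathcal F,P)$. Let $K(x,y)=x(1-y)$ for $0\le x\le y\le1$ and $K(x,y)=y(1-x)$ for $0\le y\le x\le1$. The processes $u$ and $v$ are the unique solutions of the stochastic differential equations $$u(x)-x=-\int_0^1K(x,y)u(y)\,dB(y),\qquad v(x)+x-1=-\int_0^1K(x,y)v(y)\,dB(y);$$ they have differentiable paths, satisfy $u(0)=0$, $u(1)=1$, $v(0)=1$, $v(1)=0$, and are two linearly independent solutions of the homogeneous problem: for all $h\in H_1$, almost surely $\int_0^1u'h'\,dx+\int_0^1uh\,dB=0$ and likewise for $v$, and for almost all $\omega\in\Omega$ the paths of $u$ and $v$ are linearly independent functions. The random variable $\alpha$ is $\alpha:=u'(x)v(x)-u(x)v'(x)$, which almost surely is a positive constant for all $x\in[0,1]$. *)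

theory Defs
  imports "HOL-Probability.Probability"
begin

text \<open>Functions on the unit interval are elements of \<open>extensional {0..1}\<close>, so that equality
  of functions is equality on \<open>[0,1]\<close>. Derivatives are taken within \<open>[0,1]\<close>: one-sided at the
  endpoints and two-sided inside. Where a function is not differentiable the value is
  arbitrary; for absolutely continuous functions this is a null set.\<close>

abbreviation deriv01 :: "(real \<Rightarrow> real) \<Rightarrow> real \<Rightarrow> real" where
  "deriv01 f x \<equiv> vector_derivative f (at x within {0..1})"

definition abs_continuous_on01 :: "(real \<Rightarrow> real) \<Rightarrow> bool" where
  "abs_continuous_on01 f \<longleftrightarrow>
     (\<forall>e>0. \<exists>d>0. \<forall>D S. D division_of S \<and> S \<subseteq> {0..1} \<and> (\<Sum>k\<in>D. Sup k - Inf k) < d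
        \<longrightarrow> (\<Sum>k\<in>D. \<bar>f (Sup k) - f (Inf k)\<bar>) < e)"

definition H :: "(real \<Rightarrow> real) set" where
  "H = {h \<in> extensional {0..1}.
          h \<in> borel_measurable (lebesgue_on {0..1}) \<and>
          integrable (lebesgue_on {0..1}) (\<lambda>x. (h x)\<^sup>2) \<and> h 0 = 0 \<and> h 1 = 0}"

definition H1 :: "(real \<Rightarrow> real) set" where
  "H1 = {h \<in> H. abs_continuous_on01 h}"

locale brownian_motion01 = prob_space M
  for M :: "'a measure" and F :: "real \<Rightarrow> 'a measure" and B :: "real \<Rightarrow> 'a \<Rightarrow> real" +
  assumes filtration_sub: "\<And>t. t \<in> {0..1} \<Longrightarrow> subalgebra M (F t)"
    and filtration_mono: "\<And>s t. 0 \<le> s \<Longrightarrow> s \<le> t \<Longrightarrow> t \<le> 1 \<Longrightarrow> subalgebra (F t) (F s)"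
    and adapted: "\<And>t. t \<in> {0..1} \<Longrightarrow> B t \<in> borel_measurable (F t)"
    and start: "AE \<omega> in M. B 0 \<omega> = 0"
    and gaussian_increments: "\<And>s t. 0 \<le> s \<Longrightarrow> s < t \<Longrightarrow> t \<le> 1 \<Longrightarrow>
      distributed M lborel (\<lambda>\<omega>. B t \<omega> - B s \<omega>) (normal_density 0 (sqrt (t - s)))"
    and independent_increments: "\<And>s t. 0 \<le> s \<Longrightarrow> s < t \<Longrightarrow> t \<le> 1 \<Longrightarrow>
      indep_set (sets (F s)) {(\<lambda>\<omega>. B t \<omega> - B s \<omega>) -` C \<inter> space M | C. C \<in> sets borel}"
    and continuous_paths: "AE \<omega> in M. continuous_on {0..1} (\<lambda>t. B t \<omega>)"

text \<open>The integral \<open>\<integral>\<^sub>0\<^sup>1 X dB\<close> along a path \<open>b\<close> of \<open>B\<close> is the limit of Riemann-Stieltjes sums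
  as the mesh tends to zero. The solutions \<open>u\<close> and \<open>v\<close> below satisfy a two-point boundary
  condition, so they are not adapted and an Ito integral is not available. For integrands with
  paths of finite variation the pathwise integral exists, and for adapted ones it agrees with
  the Ito integral.\<close>

definition has_stieltjes_integral01 ::
  "(real \<Rightarrow> real) \<Rightarrow> (real \<Rightarrow> real) \<Rightarrow> real \<Rightarrow> bool" where
  "has_stieltjes_integral01 X b I \<longleftrightarrow>
     (\<forall>e>0. \<exists>d>0. \<forall>p. p tagged_division_of {0..1} \<and> (\<lambda>x. ball x d) fine p
        \<longrightarrow> \<bar>(\<Sum>(x,k)\<in>p. X x * (b (Sup k) - b (Inf k))) - I\<bar> < e)"

definition K :: "real \<Rightarrow> real \<Rightarrow> real" where
  "K x y = (if x \<le> y then x * (1 - y) else y * (1 - x))"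

text \<open>The process \<open>w\<close> solves \<open>w(x) - \<phi>(x) = - \<integral>\<^sub>0\<^sup>1 K(x,y) w(y) dB(y)\<close> on \<open>[0,1]\<close>; the equation
  identifies the two sides up to indistinguishability.\<close>

definition solves_sde :: "'a measure \<Rightarrow> (real \<Rightarrow> 'a \<Rightarrow> real) \<Rightarrow> (real \<Rightarrow> real) \<Rightarrow>
    (real \<Rightarrow> 'a \<Rightarrow> real) \<Rightarrow> bool" where
  "solves_sde M B \<phi> w \<longleftrightarrow>
     (\<forall>x\<in>{0..1}. w x \<in> borel_measurable M) \<and>
     (AE \<omega> in M. (\<lambda>x. w x \<omega>) differentiable_on {0..1}) \<and>
     (AE \<omega> in M. \<forall>x\<in>{0..1}. \<exists>I.
        has_stieltjes_integral01 (\<lambda>y. K x y * w y \<omega>) (\<lambda>y. B y \<omega>) I \<and> w x \<omega> - \<phi> x = - I)"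

definition form :: "(real \<Rightarrow> real) \<Rightarrow> (real \<Rightarrow> real) \<Rightarrow> (real \<Rightarrow> real) \<Rightarrow> real" where
  "form b f g =
     (LINT x:{0..1}|lebesgue. deriv01 f x * deriv01 g x) -
     (LINT x:{0..1}|lebesgue. (deriv01 f x * g x + f x * deriv01 g x) * b x)"

text \<open>The graph of the operator associated with the form. For absolutely continuous \<open>f\<close> and
  \<open>h\<close> the product \<open>f' h'\<close> need not be integrable, so the identity defining the operator
  includes the requirement that the form at \<open>(f, h)\<close> exists.\<close>

definition L_tilde :: "(real \<Rightarrow> real) \<Rightarrow> ((real \<Rightarrow> real) \<times> (real \<Rightarrow> real)) set" where
  "L_tilde b = {(f, g). f \<in> H1 \<and> g \<in> H1 \<and>
     (\<forall>h\<in>H1. set_integrable lebesgue {0..1} (\<lambda>x. deriv01 f x * deriv01 h x) \<and>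
             form b f h = (LINT x:{0..1}|lebesgue. g x * h x))}"

definition \<alpha> :: "(real \<Rightarrow> real) \<Rightarrow> (real \<Rightarrow> real) \<Rightarrow> real" where
  "\<alpha> u v = (THE a. \<forall>x\<in>{0..1}. a = deriv01 u x * v x - u x * deriv01 v x)"

definition G :: "(real \<Rightarrow> real) \<Rightarrow> (real \<Rightarrow> real) \<Rightarrow> real \<Rightarrow> real \<Rightarrow> real" where
  "G u v x y = (if y \<le> x then u y * v x else u x * v y)"

definition T :: "(real \<Rightarrow> real) \<Rightarrow> (real \<Rightarrow> real) \<Rightarrow> (real \<Rightarrow> real) \<Rightarrow> real \<Rightarrow> real" where
  "T u v f = (\<lambda>x\<in>{0..1}. 1 / \<alpha> u v * (LINT y:{0..1}|lebesgue. G u v x y * f y))"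

end

theory Submission
  imports Defs
begin

text \<open>Along almost every path \<open>b\<close> of \<open>B\<close> the statement is deterministic. Integration by parts turns
  the Stieltjes integral equation for \<open>u\<close> into the system \<open>u' = w + b u\<close>, \<open>w' = - b (w + b u)\<close> on
  \<open>[0,1]\<close> with the quasi-derivative \<open>w = u' - b u\<close>. Variation of constants then shows that \<open>f = T g\<close>
  satisfies \<open>f' = w + b f\<close>, \<open>w' = - b (w + b f) - g\<close>. Multiplying by \<open>h \<in> H1\<close> and integrating by
  parts gives \<open>\<E>(T g, h) = \<integral> g h\<close>; this uses that absolutely continuous functions are the
  integrals of their derivatives (positive variation, Radon-Nikodym, Lebesgue differentiation).
  Conversely, if \<open>\<E>(f, h) = \<integral> g h\<close> for all \<open>h \<in> H1\<close>, put \<open>k = f - T g\<close>. By symmetry of the form,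
  \<open>\<integral> k f = \<E>(T k, f) = \<integral> g (T k) = \<E>(T g, T k) = \<integral> k (T g)\<close>, so \<open>\<integral> k\<^sup>2 = 0\<close>.\<close>

section \<open>The positive variation of an absolutely continuous function\<close>

text \<open>Its integrability is extracted from the equation itself, in the gauge sense, and
  continuity of \<open>u'\<close> is a conclusion, reached through the second mean value theorem.
  The quasi-derivative arises because the operator is formally \<open>- f'' + B' f\<close>:
  differentiating \<open>w = f' - b f\<close> cancels the noise \<open>B'\<close> and leaves only
  the continuous path \<open>b\<close>. Members of \<open>H1\<close> have a derivative that is
  merely integrable, so \<open>f' h'\<close> need not be integrable for a general pair. It is
  integrable for \<open>(T g, h)\<close>, since \<open>T g\<close> has a continuous derivative; the
  converse evaluates the form only at pairs with one entry in the range of \<open>T\<close>. That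
  \<open>\<alpha>\<close> is nonzero is a Gronwall argument: a vanishing Wronskian would give
  \<open>u\<close> zero initial data, against \<open>u 1 = 1\<close>.\<close>

fun chain :: "real \<Rightarrow> (real \<times> real) list \<Rightarrow> real \<Rightarrow> bool" where
  "chain a [] c \<longleftrightarrow> a \<le> c"
| "chain a ((x, y) # ps) c \<longleftrightarrow> a \<le> x \<and> x \<le> y \<and> chain y ps c"

definition chain_sum :: "(real \<Rightarrow> real) \<Rightarrow> (real \<times> real) list \<Rightarrow> real" where
  "chain_sum f ps = (\<Sum>(x, y)\<leftarrow>ps. f y - f x)"

abbreviation chain_length :: "(real \<times> real) list \<Rightarrow> real" where
  "chain_length \<equiv> chain_sum (\<lambda>x. x)"

lemma chain_sum_simps [simp]:
  "chain_sum f [] = 0"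
  "chain_sum f ((x, y) # ps) = f y - f x + chain_sum f ps"
  "chain_sum f (ps @ qs) = chain_sum f ps + chain_sum f qs"
  by (simp_all add: chain_sum_def)

lemma chain_le: "chain a ps c \<Longrightarrow> a \<le> c"
  by (induction a ps c rule: chain.induct) auto

lemma chain_append: "chain a ps b \<Longrightarrow> chain b qs c \<Longrightarrow> chain a (ps @ qs) c"
proof (induction a ps b rule: chain.induct)
  case (1 a b)
  then show ?case by (cases qs) auto
qed auto

lemma chain_widen: "chain a ps c \<Longrightarrow> a' \<le> a \<Longrightarrow> c \<le> c' \<Longrightarrow> chain a' ps c'"
  by (induction a ps c arbitrary: a' rule: chain.induct) auto

lemma chain_length_le: "chain a ps c \<Longrightarrow> chain_length ps \<le> c - a"
  by (induction a ps c rule: chain.induct) auto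

lemma chain_sum_diff: "chain_sum (\<lambda>x. f x - g x) ps = chain_sum f ps - chain_sum g ps"
  by (induction ps) auto

lemma chain_map_min:
  "chain a ps c \<Longrightarrow> chain (min a b) (map (\<lambda>(x, y). (min x b, min y b)) ps) (min c b)"
  by (induction a ps c rule: chain.induct) auto

lemma chain_map_max:
  "chain a ps c \<Longrightarrow> chain (max a b) (map (\<lambda>(x, y). (max x b, max y b)) ps) (max c b)"
  by (induction a ps c rule: chain.induct) auto

text \<open>Every interval is clipped at \<open>b\<close> from above for \<open>qs\<close> and from
  below for \<open>rs\<close>. Intervals on the wrong side collapse to points, which is why
  \<open>chain\<close> admits degenerate intervals; they contribute nothing to any sum.\<close>

lemma chain_cut:
  assumes "chain a ps c" "a \<le> b" "b \<le> c"
  obtains qs rs where "chain a qs b" "chain b rs c"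
    "\<And>f. chain_sum f ps = chain_sum f qs + chain_sum f rs"
proof
  let ?qs = "map (\<lambda>(x, y). (min x b, min y b)) ps"
  let ?rs = "map (\<lambda>(x, y). (max x b, max y b)) ps"
  show "chain a ?qs b" "chain b ?rs c"
    using chain_map_min[OF assms(1), of b] chain_map_max[OF assms(1), of b] assms(2,3)
    by (simp_all add: min_absorb1 min_absorb2 max_absorb1 max_absorb2)
  show "chain_sum f ps = chain_sum f ?qs + chain_sum f ?rs" for f
    by (induction ps) (auto simp: min_def max_def)
qed

text \<open>Translates lists, which are easy to cut and join, into the divisions of
  \<open>abs_continuous_on01\<close>. Degenerate pairs are dropped, since repeated ones would merge
  in a set; hence \<open>F\<close> must vanish on the diagonal. \<open>F\<close> is quantified
  inside so that one division serves lengths and increments alike.\<close>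

lemma chain_division_exists:
  "chain a ps c \<Longrightarrow> \<exists>D S. D division_of S \<and> S \<subseteq> {a..c} \<and>
    (\<forall>F::real \<Rightarrow> real \<Rightarrow> real. (\<forall>x. F x x = 0) \<longrightarrow>
      (\<Sum>k\<in>D. F (Inf k) (Sup k)) = (\<Sum>(x, y)\<leftarrow>ps. F x y))"
proof (induction a ps c rule: chain.induct)
  case (1 a c)
  show ?case
    by (intro exI[of _ "{}"]) simp
next
  case (2 a x y ps c)
  then have le: "a \<le> x" "x \<le> y" "y \<le> c" and "chain y ps c"
    using chain_le[of y ps c] by simp_all
  with 2 obtain D S where D: "D division_of S" "S \<subseteq> {y..c}" and
    sumD: "\<And>F::real \<Rightarrow> real \<Rightarrow> real. (\<forall>x. F x x = 0) \<Longrightarrow>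
    (\<Sum>k\<in>D. F (Inf k) (Sup k)) = (\<Sum>(x, y)\<leftarrow>ps. F x y)"
    by meson
  show ?case
  proof (cases "x = y")
    case True
    have "S \<subseteq> {a..c}" using D(2) le by fastforce
    with D(1) sumD True show ?thesis
      by (intro exI[of _ D] exI[of _ S]) auto
  next
    case False
    then have "x < y" using le by simp
    have notin: "{x..y} \<notin> D"
    proof
      assume "{x..y} \<in> D"
      then have "{x..y} \<subseteq> {y..c}" using D by (metis division_ofD(2) order_trans)
      then show False using \<open>x < y\<close> by auto
    qed
    have fin: "finite D" using D by auto
    have disj: "interior {x..y} \<inter> interior S = {}"
    proof -
      have "interior S \<subseteq> interior {y..c}" using D(2) by (rule interior_mono)
      then show ?thesis by auto
    qed
    have "{{x..y}} division_of {x..y}"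
      using le division_of_self[of x y] by (simp add: cbox_interval)
    from division_disjoint_union[OF this D(1) disj]
    have ins: "insert {x..y} D division_of ({x..y} \<union> S)" by simp
    have "S \<subseteq> {a..c}" "{x..y} \<subseteq> {a..c}" using D(2) le by fastforce+
    with ins sumD notin fin le show ?thesis
      by (intro exI[of _ "insert {x..y} D"] exI[of _ "{x..y} \<union> S"]) auto
  qed
qed

lemma abs_continuous_on01_chain:
  assumes "abs_continuous_on01 h" "e > 0"
  obtains d where "d > 0"
    "\<And>ps. chain 0 ps 1 \<Longrightarrow> chain_length ps < d \<Longrightarrow> \<bar>chain_sum h ps\<bar> < e"
proof -
  obtain d where "d > 0" and d: "\<And>D S. D division_of S \<Longrightarrow> S \<subseteq> {0..1} \<Longrightarrow>
      (\<Sum>k\<in>D. Sup k - Inf k) < d \<Longrightarrow> (\<Sum>k\<in>D. \<bar>h (Sup k) - h (Inf k)\<bar>) < e"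
    using assms(1)[unfolded abs_continuous_on01_def, rule_format, OF assms(2)] by metis
  show thesis
  proof
    fix ps assume ps: "chain 0 ps 1" "chain_length ps < d"
    obtain D S where D: "D division_of S" "S \<subseteq> {0..1}" and
      sumD: "\<And>F::real \<Rightarrow> real \<Rightarrow> real. (\<forall>x. F x x = 0) \<Longrightarrow>
      (\<Sum>k\<in>D. F (Inf k) (Sup k)) = (\<Sum>(x, y)\<leftarrow>ps. F x y)"
      using chain_division_exists[OF ps(1)] by blast
    have "(\<Sum>k\<in>D. Sup k - Inf k) < d"
      using ps(2) sumD[of "\<lambda>x y. y - x"] by (simp add: chain_sum_def)
    then have "(\<Sum>k\<in>D. \<bar>h (Sup k) - h (Inf k)\<bar>) < e" using d D by blast
    moreover have "chain_sum h ps = (\<Sum>k\<in>D. h (Sup k) - h (Inf k))"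
      using sumD[of "\<lambda>x y. h y - h x"] by (simp add: chain_sum_def)
    ultimately show "\<bar>chain_sum h ps\<bar> < e"
      by (metis sum_abs order_le_less_trans)
  qed fact
qed

text \<open>A chain need not cover \<open>[0,x]\<close>, so this is the positive and not the total variation.\<close>

definition pos_var :: "(real \<Rightarrow> real) \<Rightarrow> real \<Rightarrow> real" where
  "pos_var h x = (SUP ps\<in>{ps. chain 0 ps x}. chain_sum h ps)"

context
  fixes h assumes h: "abs_continuous_on01 h"
begin

text \<open>Cut the unit interval into \<open>N\<close> pieces shorter than the \<open>d\<close>
  belonging to the bound 1. A chain inside one piece has sum below 1, so induction over the pieces
  bounds any chain; the extra 1 in \<open>k + 1\<close> pays for degenerate chains at 0.\<close>

lemma chain_sum_bounded:
  obtains C where "\<And>x ps. x \<in> {0..1} \<Longrightarrow> chain 0 ps x \<Longrightarrow> chain_sum h ps \<le> C"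
proof -
  obtain d where d: "d > 0"
    "\<And>ps. chain 0 ps 1 \<Longrightarrow> chain_length ps < d \<Longrightarrow> \<bar>chain_sum h ps\<bar> < 1"
    using abs_continuous_on01_chain[OF h, of 1] by auto
  obtain N :: nat where N: "N > 0" "1 / N < d"
  proof -
    obtain n :: nat where "1 / real (Suc n) < d" using d(1) nat_approx_posE by blast
    then show thesis using that[of "Suc n"] by simp
  qed
  have *: "k \<le> N \<Longrightarrow> chain 0 ps (k / N) \<Longrightarrow> chain_sum h ps \<le> k + 1" for k ps
  proof (induction k arbitrary: ps)
    case 0
    then have ps: "chain 0 ps 0" by simp
    then have "\<bar>chain_sum h ps\<bar> < 1"
      using chain_length_le[OF ps] chain_widen[OF ps, of 0 1] d by simp
    then show ?case by simp
  next
    case (Suc k)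
    obtain qs rs where qr: "chain 0 qs (k / N)" "chain (k / N) rs (Suc k / N)"
      "chain_sum h ps = chain_sum h qs + chain_sum h rs"
    proof (rule chain_cut[OF Suc.prems(2)])
      show "0 \<le> real k / real N" "real k / real N \<le> real (Suc k) / real N"
        by (simp_all add: divide_right_mono)
    qed blast
    have "chain_length rs < d"
      using chain_length_le[OF qr(2)] N by (simp add: add_divide_distrib)
    moreover have "chain 0 rs 1"
      using chain_widen[OF qr(2), of 0 1] Suc.prems(1) by (simp add: divide_simps)
    ultimately have "chain_sum h rs < 1" using d(2) by fastforce
    then show ?case using Suc.IH[OF _ qr(1)] Suc.prems(1) qr(3) by simp
  qed
  show thesis
  proof (rule that[of "real N + 1"])
    fix x ps assume "x \<in> {0..1::real}" "chain 0 ps x"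
    then have "chain 0 ps (N / N)" using chain_widen[of 0 ps x 0 1] N by auto
    then show "chain_sum h ps \<le> real N + 1" using *[of N ps] by simp
  qed
qed

lemma bdd_above_chain_sum:
  assumes "x \<in> {0..1}"
  shows "bdd_above (chain_sum h ` {ps. chain 0 ps x})"
proof -
  obtain C where "\<And>x ps. x \<in> {0..1} \<Longrightarrow> chain 0 ps x \<Longrightarrow> chain_sum h ps \<le> C"
    using chain_sum_bounded by blast
  with assms show ?thesis by (intro bdd_aboveI2[of _ _ C]) blast
qed

lemma pos_var_upper: "x \<in> {0..1} \<Longrightarrow> chain 0 ps x \<Longrightarrow> chain_sum h ps \<le> pos_var h x"
  unfolding pos_var_def by (rule cSUP_upper) (auto intro: bdd_above_chain_sum)

lemma pos_var_approx:
  assumes "x \<in> {0..1}" "e > 0"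
  obtains ps where "chain 0 ps x" "pos_var h x < chain_sum h ps + e"
proof -
  have "{ps. chain 0 ps x} \<noteq> {}" using assms chain.simps(1)[of 0 x] by fastforce
  moreover have "pos_var h x - e < (SUP ps\<in>{ps. chain 0 ps x}. chain_sum h ps)"
    using assms by (simp add: pos_var_def)
  ultimately have "\<exists>ps\<in>{ps. chain 0 ps x}. pos_var h x - e < chain_sum h ps"
    using less_cSUP_iff[OF _ bdd_above_chain_sum[OF assms(1)]] by blast
  then show thesis using that by (auto simp: algebra_simps)
qed

lemma pos_var_superadditive:
  assumes "0 \<le> x" "x \<le> y" "y \<le> 1" "chain x qs y"
  shows "pos_var h x + chain_sum h qs \<le> pos_var h y"
proof (rule field_le_epsilon)
  fix e :: real assume "e > 0"
  then obtain ps where ps: "chain 0 ps x" "pos_var h x < chain_sum h ps + e"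
    using pos_var_approx[of x e] assms by auto
  have "chain_sum h (ps @ qs) \<le> pos_var h y"
    using assms chain_append[OF ps(1) assms(4)] by (intro pos_var_upper) auto
  then show "pos_var h x + chain_sum h qs \<le> pos_var h y + e" using ps by simp
qed

lemma pos_var_mono: "0 \<le> x \<Longrightarrow> x \<le> y \<Longrightarrow> y \<le> 1 \<Longrightarrow> pos_var h x \<le> pos_var h y"
  using pos_var_superadditive[of x y "[]"] by simp

text \<open>A chain up to \<open>x\<close> may be extended by the single interval from
  \<open>x\<close> to \<open>y\<close>. This completes the Jordan decomposition of \<open>h\<close>
  into the increasing functions \<open>pos_var h\<close> and \<open>pos_var h - h\<close>, which
  reduces the density theorem to monotone functions.\<close>

lemma pos_var_diff_mono:
  "0 \<le> x \<Longrightarrow> x \<le> y \<Longrightarrow> y \<le> 1 \<Longrightarrow> pos_var h x - h x \<le> pos_var h y - h y"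
  using pos_var_superadditive[of x y "[(x, y)]"] by simp

text \<open>A nearly optimal chain up to \<open>y\<close> is cut at \<open>x\<close>. The piece
  below \<open>x\<close> contributes at most \<open>pos_var h x\<close>, so the rest must nearly
  attain the increment.\<close>

lemma pos_var_increment_approx:
  assumes "0 \<le> x" "x \<le> y" "y \<le> 1" "e > 0"
  obtains qs where "chain x qs y" "pos_var h y - pos_var h x \<le> chain_sum h qs + e"
proof -
  obtain ps where ps: "chain 0 ps y" "pos_var h y < chain_sum h ps + e"
    using pos_var_approx[of y e] assms by auto
  obtain qs rs where qr: "chain 0 qs x" "chain x rs y"
      "chain_sum h ps = chain_sum h qs + chain_sum h rs"
    by (rule chain_cut[OF ps(1) assms(1,2)]) blast
  have "chain_sum h qs \<le> pos_var h x" using qr assms by (intro pos_var_upper) auto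
  then show thesis using that[OF qr(2)] qr(3) ps(2) by simp
qed

text \<open>Each interval of \<open>ps\<close> is replaced by a nearly optimal chain inside it, with
  the error halved at every step. Total length cannot grow, so a \<open>d\<close> that works for
  \<open>h\<close> also works for \<open>pos_var h\<close>: absolute continuity passes to the
  positive variation.\<close>

lemma pos_var_chain_approx:
  "chain a ps c \<Longrightarrow> 0 \<le> a \<Longrightarrow> c \<le> 1 \<Longrightarrow> e > 0 \<Longrightarrow> \<exists>qs. chain a qs c \<and>
    chain_length qs \<le> chain_length ps \<and> chain_sum (pos_var h) ps \<le> chain_sum h qs + e"
proof (induction a ps c arbitrary: e rule: chain.induct)
  case (1 a c)
  then show ?case by (intro exI[of _ "[]"]) simp
next
  case (2 a x y ps c)
  then have le: "a \<le> x" "x \<le> y" "y \<le> c" and "chain y ps c"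
    using chain_le[of y ps c] by simp_all
  with 2 obtain qs where qs: "chain y qs c" "chain_length qs \<le> chain_length ps"
      "chain_sum (pos_var h) ps \<le> chain_sum h qs + e/2"
    using "2.IH"[of "e/2"] by (meson half_gt_zero order_trans)
  obtain rs where rs: "chain x rs y" "pos_var h y - pos_var h x \<le> chain_sum h rs + e/2"
    using pos_var_increment_approx[of x y "e/2"] le 2 by auto
  have "chain a (rs @ qs) c" using chain_append rs(1) qs(1) chain_widen le by blast
  with qs rs chain_length_le[OF rs(1)] show ?case
    by (intro exI[of _ "rs @ qs"]) auto
qed

lemma pos_var_chain_small:
  assumes "e > 0"
  obtains d where "d > 0"
    "\<And>ps. chain 0 ps 1 \<Longrightarrow> chain_length ps < d \<Longrightarrow> chain_sum (pos_var h) ps < e"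
proof -
  obtain d where d: "d > 0"
    "\<And>ps. chain 0 ps 1 \<Longrightarrow> chain_length ps < d \<Longrightarrow> \<bar>chain_sum h ps\<bar> < e/2"
    using abs_continuous_on01_chain[OF h, of "e/2"] assms by auto
  show thesis
  proof (rule that[OF d(1)])
    fix ps assume ps: "chain 0 ps 1" "chain_length ps < d"
    obtain qs where qs: "chain 0 qs 1" "chain_length qs \<le> chain_length ps"
      "chain_sum (pos_var h) ps \<le> chain_sum h qs + e/2"
      using pos_var_chain_approx[OF ps(1), of "e/2"] assms by auto
    then have "\<bar>chain_sum h qs\<bar> < e/2" using d(2) ps by auto
    with qs show "chain_sum (pos_var h) ps < e" by auto
  qed
qed

end

section \<open>Density of an absolutely continuous function\<close>

fun cell_chain :: "(nat \<Rightarrow> bool) \<Rightarrow> nat \<Rightarrow> nat \<Rightarrow> (real \<times> real) list" where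
  "cell_chain Q n 0 = []"
| "cell_chain Q n (Suc m) = cell_chain Q n m @ (if Q m then [(m / n, Suc m / n)] else [])"

text \<open>The point set belonging to \<open>cell_chain\<close>. Cells are half-open so that they
  are disjoint and an interval measure assigns to each exactly the increment of its distribution
  function.\<close>

definition cells :: "(nat \<Rightarrow> bool) \<Rightarrow> nat \<Rightarrow> nat \<Rightarrow> real set" where
  "cells Q n m = (\<Union>k\<in>{k. k < m \<and> Q k}. {k / n<..Suc k / n})"

lemma cells_borel [measurable]: "cells Q n m \<in> sets borel"
  by (auto simp: cells_def)

lemma cells_0 [simp]: "cells Q n 0 = {}"
  by (simp add: cells_def)

lemma cells_Suc: "cells Q n (Suc m) = cells Q n m \<union> (if Q m then {m / n<..Suc m / n} else {})"
  by (auto simp: cells_def less_Suc_eq)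

lemma cells_le: "x \<in> cells Q n m \<Longrightarrow> x \<le> m / n"
proof -
  assume "x \<in> cells Q n m"
  then obtain k where "k < m" "x \<le> Suc k / n" by (auto simp: cells_def)
  moreover have "real (Suc k) / n \<le> m / n" using \<open>k < m\<close> by (intro divide_right_mono) auto
  ultimately show "x \<le> m / n" by simp
qed

lemma chain_cell_chain: "chain 0 (cell_chain Q n m) (m / n)"
proof (induction m)
  case (Suc m)
  have "real m / n \<le> real (Suc m) / n" by (intro divide_right_mono) auto
  then have "chain (real m / n) (if Q m then [(m / n, Suc m / n)] else []) (Suc m / n)" by simp
  then show ?case using chain_append[OF Suc] by simp
qed simp

text \<open>Applied to the same cells twice: Lebesgue measure with the identity gives
  \<open>chain_length\<close>, the Stieltjes measure of \<open>f\<close> gives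
  \<open>chain_sum f\<close>. Absolute continuity compares these two numbers.\<close>

lemma emeasure_cells:
  assumes [measurable_cong]: "sets \<mu> = sets borel"
    and \<mu>: "\<And>a b. 0 \<le> a \<Longrightarrow> a \<le> b \<Longrightarrow> b \<le> 1 \<Longrightarrow> emeasure \<mu> {a<..b} = ennreal (f b - f a)"
    and f: "\<And>a b. 0 \<le> a \<Longrightarrow> a \<le> b \<Longrightarrow> b \<le> 1 \<Longrightarrow> f a \<le> f b"
    and "m \<le> n"
  shows "emeasure \<mu> (cells Q n m) = ennreal (chain_sum f (cell_chain Q n m)) \<and>
    0 \<le> chain_sum f (cell_chain Q n m)"
  using \<open>m \<le> n\<close>
proof (induction m)
  case (Suc m)
  show ?case
  proof (cases "Q m")
    case True
    have le: "0 \<le> real m / n" "real m / n \<le> real (Suc m) / n" "real (Suc m) / n \<le> 1"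
      using Suc.prems by (auto simp: divide_simps)
    have "emeasure \<mu> (cells Q n (Suc m))
      = emeasure \<mu> (cells Q n m) + emeasure \<mu> {m / n<..Suc m / n}"
      unfolding cells_Suc using True cells_le[of _ Q n m]
      by (simp, intro plus_emeasure[symmetric]) (auto simp: assms(1), fastforce)
    also have "\<dots> = ennreal (chain_sum f (cell_chain Q n m)) + ennreal (f (Suc m / n) - f (m / n))"
      using Suc \<mu>[OF le] by simp
    also have "\<dots> = ennreal (chain_sum f (cell_chain Q n (Suc m)))"
      using f[OF le] Suc True by (subst ennreal_plus[symmetric]) auto
    finally show ?thesis using f[OF le] Suc True by auto
  qed (use Suc in \<open>auto simp: cells_Suc\<close>)
qed simp

section \<open>Exhaustion of an open set by dyadic cells\<close>

lemma mem_dyadic_cell: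
  fixes x :: real
  assumes "0 < x" "x \<le> 1"
  obtains k where "k < 2 ^ n" "real k / 2 ^ n < x" "x \<le> real (Suc k) / 2 ^ n"
proof -
  \<comment> \<open>Cells are open on the left and closed on the right, so the index is the ceiling
    minus one rather than the floor.\<close>
  define z where "z = nat \<lceil>x * 2 ^ n\<rceil>"
  have z: "real z = of_int \<lceil>x * 2 ^ n\<rceil>" using assms by (simp add: z_def)
  have "x * 2 ^ n \<le> z" "z < x * 2 ^ n + 1" unfolding z by linarith+
  moreover have "0 < x * 2 ^ n" "x * 2 ^ n \<le> 2 ^ n" using assms by auto
  ultimately have "z > 0" "real z < 2 ^ n + 1" by linarith+
  then have "z \<le> 2 ^ n"
    by (metis Suc_eq_plus1 less_Suc_eq_le of_nat_Suc of_nat_less_iff of_nat_numeral of_nat_power add.commute)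
  show thesis
    by (rule that[of "z - 1"])
      (use \<open>z > 0\<close> \<open>z \<le> 2 ^ n\<close> \<open>x * 2 ^ n \<le> z\<close> \<open>z < x * 2 ^ n + 1\<close>
        in \<open>auto simp: divide_simps of_nat_diff\<close>)
qed

text \<open>An open set may have infinitely many components, while absolute continuity speaks of
  finite families. At each level the dyadic cells whose closure lies in \<open>U\<close> form a
  finite chain; bisection makes the levels increase, and together they fill \<open>U\<close> within
  the half-open unit interval.\<close>

definition inner_cells :: "real set \<Rightarrow> nat \<Rightarrow> real set" where
  "inner_cells U n = cells (\<lambda>k. {real k / 2 ^ n..real (Suc k) / 2 ^ n} \<subseteq> U) (2 ^ n) (2 ^ n)"

lemma mem_inner_cells:
  "x \<in> inner_cells U n \<longleftrightarrow> (\<exists>k<2 ^ n. real k / 2 ^ n < x \<and> x \<le> real (Suc k) / 2 ^ n \<and>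
    {real k / 2 ^ n..real (Suc k) / 2 ^ n} \<subseteq> U)"
  by (auto simp: inner_cells_def cells_def)

lemma inner_cells_borel [measurable]: "inner_cells U n \<in> sets borel"
  by (simp add: inner_cells_def)

lemma inner_cells_subset: "inner_cells U n \<subseteq> U"
proof
  fix x assume "x \<in> inner_cells U n"
  then obtain k where "real k / 2 ^ n < x" "x \<le> real (Suc k) / 2 ^ n"
      "{real k / 2 ^ n..real (Suc k) / 2 ^ n} \<subseteq> U"
    unfolding mem_inner_cells by blast
  then show "x \<in> U" by (meson atLeastAtMost_iff less_imp_le subsetD)
qed

lemma incseq_inner_cells: "incseq (inner_cells U)"
proof (rule incseq_SucI, rule subsetI)
  fix n x assume "x \<in> inner_cells U n"
  then obtain k where k: "k < 2 ^ n" "real k / 2 ^ n < x" "x \<le> real (Suc k) / 2 ^ n"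
      "{real k / 2 ^ n..real (Suc k) / 2 ^ n} \<subseteq> U"
    by (auto simp: mem_inner_cells)
  let ?m = "(2 * real k + 1) / 2 ^ Suc n"
  have eq: "real k / 2 ^ n = real (2 * k) / 2 ^ Suc n"
    "real (Suc k) / 2 ^ n = real (Suc (2 * k + 1)) / 2 ^ Suc n"
    by (auto simp: field_simps)
  have m: "real k / 2 ^ n \<le> ?m" "?m \<le> real (Suc k) / 2 ^ n"
    by (auto simp: field_simps)
  have sub: "{real k / 2 ^ n..?m} \<subseteq> U" "{?m..real (Suc k) / 2 ^ n} \<subseteq> U"
    using k(4) m by (meson atLeastatMost_subset_iff order_refl order_trans)+
  have lt: "2 * k < 2 ^ Suc n" "2 * k + 1 < 2 ^ Suc n" using k(1) by auto
  show "x \<in> inner_cells U (Suc n)"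
  proof (cases "x \<le> ?m")
    case True
    have "?m = real (Suc (2 * k)) / 2 ^ Suc n" by simp
    with True k(2) sub(1) lt(1) eq(1) show ?thesis unfolding mem_inner_cells by metis
  next
    case False
    have "?m = real (2 * k + 1) / 2 ^ Suc n" by simp
    with False k(3) sub(2) lt(2) eq(2) show ?thesis unfolding mem_inner_cells
      by (metis not_le)
  qed
qed

lemma Union_inner_cells:
  assumes "open U"
  shows "(\<Union>n. inner_cells U n) = U \<inter> {0<..1}"
proof (intro equalityI subsetI)
  fix x assume "x \<in> U \<inter> {0<..1}"
  then obtain r where r: "r > 0" "ball x r \<subseteq> U" and x: "0 < x" "x \<le> 1"
    using assms open_contains_ball by (metis IntE greaterThanAtMost_iff)
  obtain n where n: "(1/2) ^ n < r" using r(1) real_arch_pow_inv[of r "1/2"] by auto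
  obtain k where k: "k < 2 ^ n" "real k / 2 ^ n < x" "x \<le> real (Suc k) / 2 ^ n"
    using mem_dyadic_cell[OF x] by blast
  have "real (Suc k) / 2 ^ n = real k / 2 ^ n + (1/2) ^ n"
    by (simp add: field_simps)
  then have "{real k / 2 ^ n..real (Suc k) / 2 ^ n} \<subseteq> ball x r"
    using k n by (auto simp: dist_real_def)
  then show "x \<in> (\<Union>n. inner_cells U n)" using k r by (auto simp: mem_inner_cells)
next
  fix x assume "x \<in> (\<Union>n. inner_cells U n)"
  then obtain n where n: "x \<in> inner_cells U n" by auto
  then have "x \<in> U" using inner_cells_subset by auto
  obtain k where k: "k < 2 ^ n" "real k / 2 ^ n < x" "x \<le> real (Suc k) / 2 ^ n"
    using n by (auto simp: mem_inner_cells)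
  have "0 \<le> real k / 2 ^ n" by simp
  have "real (Suc k) / 2 ^ n \<le> 1"
    using k(1) by (simp add: divide_simps) (metis Suc_eq_plus1 Suc_leI add.commute of_nat_1 of_nat_add of_nat_le_iff of_nat_numeral of_nat_power)
  have "0 < x" using k(2) \<open>0 \<le> real k / 2 ^ n\<close> by (rule le_less_trans[rotated])
  moreover have "x \<le> 1" using k(3) \<open>real (Suc k) / 2 ^ n \<le> 1\<close> by (rule order_trans)
  ultimately show "x \<in> U \<inter> {0<..1}" using \<open>x \<in> U\<close> by simp
qed

text \<open>The density is the Radon-Nikodym derivative of the Stieltjes measure of
  \<open>f\<close>. A Lebesgue null set is enclosed in an open \<open>U\<close> of measure below
  \<open>d\<close>; the inner cells of \<open>U\<close> are chains of length below \<open>d\<close>,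
  so their Stieltjes measure is below \<open>e\<close>, and continuity from below carries the bound
  \<open>e\<close> to \<open>U\<close>.\<close>

lemma mono_abs_continuous_density:
  fixes f :: "real \<Rightarrow> real"
  assumes mono: "\<And>x y. 0 \<le> x \<Longrightarrow> x \<le> y \<Longrightarrow> y \<le> 1 \<Longrightarrow> f x \<le> f y"
    and small: "\<And>e. e > 0 \<Longrightarrow> \<exists>d>0. \<forall>ps. chain 0 ps 1 \<longrightarrow> chain_length ps < d \<longrightarrow> chain_sum f ps < e"
  obtains \<phi> where "\<phi> absolutely_integrable_on {0..1}"
    "\<And>x. x \<in> {0..1} \<Longrightarrow> (\<phi> has_integral f x - f 0) {0..x}"
proof -
  \<comment> \<open>Clamping to the unit interval extends \<open>f\<close> to a monotone continuous
    function on the whole line, as \<open>interval_measure\<close> requires.\<close>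
  define c where "c = (\<lambda>x::real. max 0 (min 1 x))"
  have c01: "0 \<le> c x" "c x \<le> 1" for x by (auto simp: c_def)
  have c_mono: "x \<le> y \<Longrightarrow> c x \<le> c y" for x y by (auto simp: c_def)
  have c_id: "0 \<le> x \<Longrightarrow> x \<le> 1 \<Longrightarrow> c x = x" for x by (auto simp: c_def)
  have c_lip: "\<bar>c x - c y\<bar> \<le> \<bar>x - y\<bar>" for x y by (auto simp: c_def)
  define F where "F = (\<lambda>x. f (c x))"
  have F_mono: "x \<le> y \<Longrightarrow> F x \<le> F y" for x y
    unfolding F_def by (intro mono c01 c_mono)
  have F_id: "0 \<le> x \<Longrightarrow> x \<le> 1 \<Longrightarrow> F x = f x" for x by (simp add: F_def c_id)
  have "continuous_on UNIV F"
    unfolding continuous_on_iff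
  proof (intro ballI allI impI)
    fix x e :: real assume "e > 0"
    then obtain d where d: "d > 0"
      "\<And>ps. chain 0 ps 1 \<Longrightarrow> chain_length ps < d \<Longrightarrow> chain_sum f ps < e" using small by blast
    have *: "F y - F x < e" if "x \<le> y" "\<bar>x - y\<bar> < d" for x y
    proof -
      have "chain 0 [(c x, c y)] 1" using c01 c_mono[OF that(1)] by simp
      moreover have "chain_length [(c x, c y)] < d" using c_lip[of x y] that by simp
      ultimately have "chain_sum f [(c x, c y)] < e" by (rule d(2))
      then show ?thesis by (simp add: F_def)
    qed
    show "\<exists>d>0. \<forall>y\<in>UNIV. dist y x < d \<longrightarrow> dist (F y) (F x) < e"
    proof (intro exI[of _ d] conjI ballI impI)
      fix y assume "dist y x < d"
      then show "dist (F y) (F x) < e"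
        using *[of x y] *[of y x] F_mono[of x y] F_mono[of y x]
        by (cases "x \<le> y") (auto simp: dist_real_def)
    qed fact
  qed
  then have F_cont: "continuous (at_right a) F" for a
    by (simp add: continuous_on_eq_continuous_at continuous_at_imp_continuous_at_within)
  define \<nu> where "\<nu> = interval_measure F"
  have \<nu>_sets [simp, measurable_cong]: "sets \<nu> = sets borel" by (simp add: \<nu>_def)
  have \<nu>_Ioc: "emeasure \<nu> {a<..b} = ennreal (F b - F a)" if "a \<le> b" for a b
    unfolding \<nu>_def using that F_mono F_cont by (rule emeasure_interval_measure_Ioc)
  have \<nu>_Icc: "emeasure \<nu> {a..b} = ennreal (F b - F a)" if "a \<le> b" for a b
    unfolding \<nu>_def using that F_mono \<open>continuous_on UNIV F\<close> by (rule emeasure_interval_measure_Icc)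
  \<comment> \<open>\<open>F\<close> is constant to the left of 0 and to the right of 1, so all mass
    lies in the part of the line that the inner cells can exhaust.\<close>
  have null_outside: "- {0<..1} \<in> null_sets \<nu>"
  proof -
    have "{- real n<..0} \<in> null_sets \<nu>" "{1<..1 + real n} \<in> null_sets \<nu>" for n
      by (auto simp: null_sets_def \<nu>_Ioc F_def c_def)
    then have "(\<Union>n. {- real n<..0} \<union> {1<..1 + real n}) \<in> null_sets \<nu>" by auto
    also have "(\<Union>n. {- real n<..0} \<union> {1<..1 + real n}) = - {0<..1}"
    proof (intro equalityI subsetI)
      fix x :: real assume x: "x \<in> - {0<..1}"
      obtain n :: nat where "\<bar>x\<bar> < n" using reals_Archimedean2 by blast
      with x show "x \<in> (\<Union>n. {- real n<..0} \<union> {1<..1 + real n})"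
        by (auto intro!: exI[of _ n])
    qed auto
    finally show ?thesis .
  qed
  have "absolutely_continuous lborel \<nu>"
    unfolding absolutely_continuous_def
  proof
    fix N :: "real set" assume N: "N \<in> null_sets lborel"
    then have [measurable]: "N \<in> sets borel" by auto
    have "emeasure \<nu> N \<le> ennreal e" if "e > 0" for e :: real
    proof -
      obtain d where d: "d > 0"
        "\<And>ps. chain 0 ps 1 \<Longrightarrow> chain_length ps < d \<Longrightarrow> chain_sum f ps < e"
        using small \<open>e > 0\<close> by blast
      obtain U where U: "open U" "N \<subseteq> U" "emeasure lborel (U - N) < ennreal d"
        using outer_regular_lborel[of N d] d(1) by auto
      have [measurable]: "U \<in> sets borel" using U(1) by simp
      have lU: "emeasure lborel U < ennreal d"
        using U(3) emeasure_Diff_null_set[OF N, of U] by simp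
      have "emeasure \<nu> (inner_cells U n) \<le> ennreal e" for n
      proof -
        let ?Q = "\<lambda>k. {real k / 2 ^ n..real (Suc k) / 2 ^ n} \<subseteq> U"
        let ?ps = "cell_chain ?Q (2 ^ n) (2 ^ n)"
        have ch: "chain 0 ?ps 1" using chain_cell_chain[of ?Q "2 ^ n" "2 ^ n"] by simp
        have l: "emeasure lborel (inner_cells U n) = ennreal (chain_length ?ps) \<and> 0 \<le> chain_length ?ps"
          unfolding inner_cells_def by (rule emeasure_cells) auto
        have "emeasure lborel (inner_cells U n) \<le> emeasure lborel U"
          by (intro emeasure_mono inner_cells_subset) auto
        then have "ennreal (chain_length ?ps) < ennreal d" using l lU by auto
        then have "chain_length ?ps < d" using l by (simp add: ennreal_less_iff)
        then have "chain_sum f ?ps < e" using d(2) ch by blast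
        moreover have "emeasure \<nu> (inner_cells U n) = ennreal (chain_sum f ?ps) \<and> 0 \<le> chain_sum f ?ps"
          unfolding inner_cells_def
          by (rule emeasure_cells) (auto simp: \<nu>_Ioc F_id intro: mono)
        ultimately show ?thesis by (simp add: ennreal_leI)
      qed
      then have "(SUP n. emeasure \<nu> (inner_cells U n)) \<le> ennreal e" by (intro SUP_least)
      also have "(SUP n. emeasure \<nu> (inner_cells U n)) = emeasure \<nu> (\<Union>n. inner_cells U n)"
        by (rule SUP_emeasure_incseq) (auto simp: incseq_inner_cells)
      finally have "emeasure \<nu> (U \<inter> {0<..1}) \<le> ennreal e"
        using Union_inner_cells[OF U(1)] by simp
      moreover have "emeasure \<nu> N \<le> emeasure \<nu> (U \<inter> {0<..1} \<union> - {0<..1})"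
        using U(2) by (intro emeasure_mono) auto
      moreover have "\<dots> = emeasure \<nu> (U \<inter> {0<..1})"
        by (rule emeasure_Un_null_set) (auto simp: null_outside)
      ultimately show ?thesis by simp
    qed
    then have "emeasure \<nu> N \<le> 0" by - (rule ennreal_le_epsilon, simp)
    then have "emeasure \<nu> N = 0" by simp
    then show "N \<in> null_sets \<nu>" by (intro null_setsI) simp_all
  qed
  then obtain g where g [measurable]: "g \<in> borel_measurable lborel" and dens: "density lborel g = \<nu>"
    using sigma_finite_measure.Radon_Nikodym[OF sigma_finite_lborel, of \<nu>] by auto
  have nn: "(\<integral>\<^sup>+t. g t * indicator {0..x} t \<partial>lborel) = ennreal (f x - f 0)" if "x \<in> {0..1}" for x
    using \<nu>_Icc[of 0 x] that unfolding dens[symmetric] by (simp add: emeasure_density F_id)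
  define \<phi> where "\<phi> = (\<lambda>t. enn2real (g t))"
  have [measurable]: "\<phi> \<in> borel_measurable borel" using g by (simp add: \<phi>_def)
  \<comment> \<open>The total mass is finite, so the extended density is finite almost everywhere on
    the interval and \<open>enn2real\<close> loses nothing there.\<close>
  have AEg: "AE t in lborel. g t * indicator {0..1} t \<noteq> \<infinity>"
    by (rule nn_integral_PInf_AE) (use nn[of 1] in auto)
  have bi: "has_bochner_integral lborel (\<lambda>t. \<phi> t * indicator {0..x} t) (f x - f 0)" if x: "x \<in> {0..1}" for x
  proof (rule has_bochner_integral_nn_integral)
    have "(\<integral>\<^sup>+t. ennreal (\<phi> t * indicator {0..x} t) \<partial>lborel) = (\<integral>\<^sup>+t. g t * indicator {0..x} t \<partial>lborel)"
    proof (rule nn_integral_cong_AE, use AEg in eventually_elim)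
      fix t assume "g t * indicator {0..1} t \<noteq> \<infinity>"
      then show "ennreal (\<phi> t * indicator {0..x} t) = g t * indicator {0..x} t"
        using x by (auto simp: \<phi>_def indicator_def less_top)
    qed
    then show "(\<integral>\<^sup>+t. ennreal (\<phi> t * indicator {0..x} t) \<partial>lborel) = ennreal (f x - f 0)"
      using nn[OF x] by simp
  qed (use x mono[of 0 x] in \<open>auto simp: \<phi>_def\<close>)
  show thesis
  proof (rule that)
    have "set_integrable lborel {0..1} \<phi>"
      using bi[of 1] by (auto simp: set_integrable_def has_bochner_integral_iff mult.commute)
    then show "\<phi> absolutely_integrable_on {0..1}"
      using absolutely_integrable_on_def set_integrable_def
      by (metis integrable_completion borel_measurable_integrable)
    fix x :: real assume x: "x \<in> {0..1}"
    have "((\<lambda>t. \<phi> t * indicator {0..x} t) has_integral f x - f 0) UNIV"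
      using bi[OF x] has_integral_integral_lborel has_bochner_integral_iff by metis
    then show "(\<phi> has_integral f x - f 0) {0..x}"
      by (subst has_integral_restrict_UNIV[symmetric])
         (auto elim!: has_integral_eq[rotated] simp: indicator_def)
  qed
qed

lemma abs_continuous_on01_density:
  assumes h: "abs_continuous_on01 h"
  obtains \<phi> where "\<phi> absolutely_integrable_on {0..1}"
    "\<And>x. x \<in> {0..1} \<Longrightarrow> (\<phi> has_integral h x - h 0) {0..x}"
proof -
  let ?P = "pos_var h"
  have "\<exists>d>0. \<forall>ps. chain 0 ps 1 \<longrightarrow> chain_length ps < d \<longrightarrow> chain_sum ?P ps < e" if "e > 0" for e
    by (rule pos_var_chain_small[OF h that]) blast
  then obtain p where p: "p absolutely_integrable_on {0..1}"
      "\<And>x. x \<in> {0..1} \<Longrightarrow> (p has_integral ?P x - ?P 0) {0..x}"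
    using mono_abs_continuous_density[of ?P, OF pos_var_mono[OF h]] by blast
  have "\<exists>d>0. \<forall>ps. chain 0 ps 1 \<longrightarrow> chain_length ps < d \<longrightarrow> chain_sum (\<lambda>x. ?P x - h x) ps < e"
    if "e > 0" for e
  proof -
    have e2: "e / 2 > 0" using that by simp
    obtain d1 where d1: "d1 > 0"
      "\<And>ps. chain 0 ps 1 \<Longrightarrow> chain_length ps < d1 \<Longrightarrow> chain_sum ?P ps < e / 2"
      by (rule pos_var_chain_small[OF h e2]) blast
    obtain d2 where d2: "d2 > 0"
      "\<And>ps. chain 0 ps 1 \<Longrightarrow> chain_length ps < d2 \<Longrightarrow> \<bar>chain_sum h ps\<bar> < e / 2"
      by (rule abs_continuous_on01_chain[OF h e2]) blast
    have "chain_sum (\<lambda>x. ?P x - h x) ps < e" if "chain 0 ps 1" "chain_length ps < min d1 d2" for ps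
      using d1(2)[of ps] d2(2)[of ps] that unfolding chain_sum_diff by auto
    then show ?thesis using d1(1) d2(1) by (intro exI[of _ "min d1 d2"]) auto
  qed
  then obtain q where q: "q absolutely_integrable_on {0..1}"
      "\<And>x. x \<in> {0..1} \<Longrightarrow> (q has_integral (?P x - h x) - (?P 0 - h 0)) {0..x}"
    using mono_abs_continuous_density[of "\<lambda>x. ?P x - h x", OF pos_var_diff_mono[OF h]] by blast
  show thesis
  proof (rule that[of "\<lambda>x. p x - q x"])
    show "(\<lambda>x. p x - q x) absolutely_integrable_on {0..1}" using p(1) q(1) by (rule set_integral_diff)
    fix x :: real assume "x \<in> {0..1}"
    from has_integral_diff[OF p(2)[OF this] q(2)[OF this]]
    show "((\<lambda>x. p x - q x) has_integral h x - h 0) {0..x}" by simp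
  qed
qed

section \<open>The fundamental theorem of calculus for absolutely continuous functions\<close>

text \<open>The averages are over intervals with \<open>x\<close> as left endpoint, so only
  right-hand behaviour is obtained; the left side follows later by reflection. Division by the
  length is cleared to match the epsilon form of a derivative.\<close>

lemma lebesgue_differentiation_right:
  fixes \<phi> :: "real \<Rightarrow> real"
  assumes "\<And>a b. \<phi> integrable_on {a..b}"
  obtains N where "negligible N"
    "\<And>x e. x \<notin> N \<Longrightarrow> e > 0 \<Longrightarrow>
      \<exists>d>0. \<forall>y. x < y \<and> y < x + d \<longrightarrow> \<bar>integral {x..y} \<phi> - \<phi> x * (y - x)\<bar> \<le> e * (y - x)"
proof -
  obtain N where N: "negligible N" "\<And>x e. \<lbrakk>x \<notin> N; 0 < e\<rbrakk> \<Longrightarrow>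
      \<exists>d>0. \<forall>h. 0 < h \<and> h < d \<longrightarrow> norm (integral (cbox x (x + h *\<^sub>R One)) \<phi> /\<^sub>R h ^ DIM(real) - \<phi> x) < e"
    by (rule integrable_ccontinuous_explicit[of \<phi>]) (use assms in \<open>auto simp: cbox_interval\<close>)
  show thesis
  proof (rule that[OF N(1)])
    fix x e :: real assume "x \<notin> N" "e > 0"
    then obtain d where d: "d > 0"
      "\<And>h. 0 < h \<Longrightarrow> h < d \<Longrightarrow> \<bar>integral {x..x + h} \<phi> / h - \<phi> x\<bar> < e"
      using N(2)[of x e] by (auto simp: cbox_interval divide_inverse mult.commute)
    have "\<bar>integral {x..y} \<phi> - \<phi> x * (y - x)\<bar> \<le> e * (y - x)" if "x < y" "y < x + d" for y
    proof -
      have "\<bar>integral {x..y} \<phi> / (y - x) - \<phi> x\<bar> < e" using d(2)[of "y - x"] that by simp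
      then have "\<bar>integral {x..y} \<phi> / (y - x) - \<phi> x\<bar> * (y - x) \<le> e * (y - x)"
        using that by (intro mult_right_mono) auto
      moreover have "\<bar>integral {x..y} \<phi> / (y - x) - \<phi> x\<bar> * (y - x)
          = \<bar>(integral {x..y} \<phi> / (y - x) - \<phi> x) * (y - x)\<bar>"
        using that by (simp add: abs_mult)
      moreover have "(integral {x..y} \<phi> / (y - x) - \<phi> x) * (y - x) = integral {x..y} \<phi> - \<phi> x * (y - x)"
        using that by (simp add: left_diff_distrib)
      ultimately show ?thesis by simp
    qed
    then show "\<exists>d>0. \<forall>y. x < y \<and> y < x + d \<longrightarrow> \<bar>integral {x..y} \<phi> - \<phi> x * (y - x)\<bar> \<le> e * (y - x)"
      using d(1) by blast
  qed
qed

lemma indefinite_integral_derivative_ae: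
  fixes h \<phi> :: "real \<Rightarrow> real"
  assumes \<phi>: "\<phi> absolutely_integrable_on {0..1}"
    and h: "\<And>x. x \<in> {0..1} \<Longrightarrow> (\<phi> has_integral h x - h 0) {0..x}"
  obtains N where "negligible N"
    "\<And>x. x \<in> {0..1} - N \<Longrightarrow> (h has_vector_derivative \<phi> x) (at x within {0..1})"
proof -
  \<comment> \<open>Extension by zero makes the function integrable on every interval, including
    those that leave the unit interval.\<close>
  define \<psi> where "\<psi> = (\<lambda>x. if x \<in> {0..1} then \<phi> x else 0)"
  have "\<phi> integrable_on {0..1}" using \<phi> by (rule absolutely_integrable_on_def[THEN iffD1, THEN conjunct1])
  then have "\<psi> integrable_on UNIV" unfolding \<psi>_def by (subst integrable_restrict_UNIV)
  then have int: "\<psi> integrable_on {a..b}" for a b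
    using integrable_on_subinterval[of \<psi> UNIV a b] by simp
  then have int': "(\<lambda>x. \<psi> (- x)) integrable_on {a..b}" for a b
    using Henstock_Kurzweil_Integration.integrable_reflect_real[where f=\<psi> and a="- b" and b="- a"] int by simp
  obtain N1 where N1: "negligible N1" "\<And>x e. x \<notin> N1 \<Longrightarrow> e > 0 \<Longrightarrow>
      \<exists>d>0. \<forall>y. x < y \<and> y < x + d \<longrightarrow> \<bar>integral {x..y} \<psi> - \<psi> x * (y - x)\<bar> \<le> e * (y - x)"
    using lebesgue_differentiation_right[OF int] by blast
  \<comment> \<open>The right-hand statement for the reflected function at \<open>- x\<close> is the
    left-hand statement at \<open>x\<close>; its exceptional set is the mirror image of
    \<open>N2\<close>, again negligible.\<close>
  obtain N2 where N2: "negligible N2" "\<And>x e. x \<notin> N2 \<Longrightarrow> e > 0 \<Longrightarrow>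
      \<exists>d>0. \<forall>y. x < y \<and> y < x + d \<longrightarrow>
        \<bar>integral {x..y} (\<lambda>x. \<psi> (- x)) - \<psi> (- x) * (y - x)\<bar> \<le> e * (y - x)"
    using lebesgue_differentiation_right[OF int'] by blast
  have h_diff: "h y - h x = integral {x..y} \<psi>" if "0 \<le> x" "x \<le> y" "y \<le> 1" for x y
  proof -
    have "integral {0..x} \<phi> + integral {x..y} \<phi> = integral {0..y} \<phi>"
      using that h[of y] by (intro Henstock_Kurzweil_Integration.integral_combine) (auto simp: has_integral_integrable)
    moreover have "integral {x..y} \<phi> = integral {x..y} \<psi>"
      using that by (intro integral_cong) (auto simp: \<psi>_def)
    ultimately show ?thesis using h[of x] h[of y] that by (simp add: integral_unique)
  qed
  have "negligible (N1 \<union> uminus ` N2)"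
    using N1(1) negligible_differentiable_image_negligible[OF order_refl N2(1), of uminus]
    by (auto simp: differentiable_on_def)
  then show thesis
  proof (rule that)
    fix x assume x: "x \<in> {0..1} - (N1 \<union> uminus ` N2)"
    then have "x \<notin> N1" "- x \<notin> N2" by (auto simp: image_iff)
    have "(h has_derivative (\<lambda>t. \<phi> x * t)) (at x within {0..1})"
      unfolding has_derivative_within_alt2
    proof (intro conjI allI impI)
      show "bounded_linear ((*) (\<phi> x))" by (rule bounded_linear_mult_right)
      fix e :: real assume "e > 0"
      obtain d1 where d1: "d1 > 0"
        "\<And>y. x < y \<Longrightarrow> y < x + d1 \<Longrightarrow> \<bar>integral {x..y} \<psi> - \<psi> x * (y - x)\<bar> \<le> e * (y - x)"
        using N1(2)[OF \<open>x \<notin> N1\<close> \<open>e > 0\<close>] by blast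
      obtain d2 where d2: "d2 > 0" "\<And>y. - x < y \<Longrightarrow> y < - x + d2 \<Longrightarrow>
          \<bar>integral {- x..y} (\<lambda>x. \<psi> (- x)) - \<psi> (- (- x)) * (y - (- x))\<bar> \<le> e * (y - (- x))"
        using N2(2)[OF \<open>- x \<notin> N2\<close> \<open>e > 0\<close>] by blast
      have \<psi>x: "\<psi> x = \<phi> x" using x by (simp add: \<psi>_def)
      have "norm (h y - h x - \<phi> x * (y - x)) \<le> e * norm (y - x)"
        if "y \<in> {0..1}" "\<bar>y - x\<bar> < min d1 d2" for y
      proof (cases rule: linorder_cases[of x y])
        case less
        then show ?thesis using d1(2)[of y] h_diff[of x y] that x \<psi>x by (simp add: abs_le_iff)
      next
        case greater
        have "integral {- x..- y} (\<lambda>x. \<psi> (- x)) = integral {y..x} \<psi>"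
          by (rule Henstock_Kurzweil_Integration.integral_reflect_real)
        then show ?thesis
          using d2(2)[of "- y"] h_diff[of y x] that x \<psi>x greater by (simp add: abs_le_iff algebra_simps)
      qed simp
      then show "eventually (\<lambda>y. norm (h y - h x - \<phi> x * (y - x)) \<le> e * norm (y - x)) (at x within {0..1})"
        unfolding eventually_at using d1(1) d2(1)
        by (intro exI[of _ "min d1 d2"]) (auto simp: dist_real_def)
    qed
    then show "(h has_vector_derivative \<phi> x) (at x within {0..1})"
      by (simp add: has_vector_derivative_def mult.commute)
  qed
qed

lemma deriv01_eq:
  assumes "(f has_vector_derivative d) (at x within {0..1})" "x \<in> {0..1}"
  shows "deriv01 f x = d"
  using vector_derivative_within_cbox[of 0 1 x f d] assms by (simp add: cbox_interval)

text \<open>Off a null set \<open>deriv01 h\<close> coincides with the density, so its arbitrary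
  values at points of non-differentiability affect neither integrability nor the integral.\<close>

lemma abs_continuous_on01_fundamental_theorem:
  assumes "abs_continuous_on01 h"
  obtains N where "negligible N"
    "\<And>x. x \<in> {0..1} - N \<Longrightarrow> (h has_vector_derivative deriv01 h x) (at x within {0..1})"
    "deriv01 h absolutely_integrable_on {0..1}"
    "(LINT x:{0..1}|lebesgue. deriv01 h x) = h 1 - h 0"
proof -
  obtain \<phi> where \<phi>: "\<phi> absolutely_integrable_on {0..1}"
    "\<And>x. x \<in> {0..1} \<Longrightarrow> (\<phi> has_integral h x - h 0) {0..x}"
    using abs_continuous_on01_density[OF assms] by blast
  obtain N where N: "negligible N"
    "\<And>x. x \<in> {0..1} - N \<Longrightarrow> (h has_vector_derivative \<phi> x) (at x within {0..1})"
    using indefinite_integral_derivative_ae[OF \<phi>] by blast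
  have eq: "deriv01 h x = \<phi> x" if "x \<in> {0..1} - N" for x
    using deriv01_eq[OF N(2)[OF that]] that by simp
  have ai: "deriv01 h absolutely_integrable_on {0..1}"
    using \<phi>(1) N(1) eq by (rule absolutely_integrable_spike)
  have "(deriv01 h has_integral h 1 - h 0) {0..1}"
    by (rule has_integral_spike[OF N(1), of "{0..1}" _ \<phi>]) (use eq \<phi>(2)[of 1] in auto)
  then have "(LINT x:{0..1}|lebesgue. deriv01 h x) = h 1 - h 0"
    using set_lebesgue_integral_eq_integral(2)[OF ai] integral_unique by metis
  with N eq ai show thesis by (intro that[of N]) auto
qed

section \<open>Continuity and stability properties of absolutely continuous functions\<close>

lemma abs_continuous_on01_continuous:
  assumes "abs_continuous_on01 h"
  shows "continuous_on {0..1} h"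
proof -
  obtain \<phi> where \<phi>: "\<phi> absolutely_integrable_on {0..1}"
    "\<And>x. x \<in> {0..1} \<Longrightarrow> (\<phi> has_integral h x - h 0) {0..x}"
    using abs_continuous_on01_density[OF assms] by blast
  have "continuous_on {0..1} (\<lambda>x. h 0 + integral {0..x} \<phi>)"
    using \<phi>(2)[of 1] by (intro continuous_intros indefinite_integral_continuous_1) (auto simp: has_integral_integrable)
  moreover have "h 0 + integral {0..x} \<phi> = h x" if "x \<in> {0..1}" for x
    using integral_unique[OF \<phi>(2)[OF that]] by simp
  ultimately show ?thesis by (rule continuous_on_eq)
qed

text \<open>One criterion for three uses: two copies of the identity give Lipschitz functions,
  \<open>h\<close> with the identity gives products with a C1 function, and two members of
  \<open>H1\<close> give their difference.\<close>

lemma abs_continuous_on01_dominated: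
  assumes "abs_continuous_on01 h" "abs_continuous_on01 k"
    and f: "\<And>x y. 0 \<le> x \<Longrightarrow> x \<le> y \<Longrightarrow> y \<le> 1 \<Longrightarrow> \<bar>f y - f x\<bar> \<le> A * \<bar>h y - h x\<bar> + C * \<bar>k y - k x\<bar>"
    and AC: "A \<ge> 0" "C \<ge> 0"
  shows "abs_continuous_on01 f"
  unfolding abs_continuous_on01_def
proof (intro allI impI)
  fix e :: real assume "e > 0"
  \<comment> \<open>The constants are enlarged by 1 because \<open>A\<close> or \<open>C\<close> may
    be zero.\<close>
  then have e': "e / (2 * (A + 1)) > 0" "e / (2 * (C + 1)) > 0" using AC by auto
  obtain d1 where d1: "d1 > 0" "\<forall>D S. D division_of S \<and> S \<subseteq> {0..1} \<and> (\<Sum>k\<in>D. Sup k - Inf k) < d1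
        \<longrightarrow> (\<Sum>k\<in>D. \<bar>h (Sup k) - h (Inf k)\<bar>) < e / (2 * (A + 1))"
    using assms(1)[unfolded abs_continuous_on01_def, rule_format, OF e'(1)] by metis
  obtain d2 where d2: "d2 > 0" "\<forall>D S. D division_of S \<and> S \<subseteq> {0..1} \<and> (\<Sum>k\<in>D. Sup k - Inf k) < d2
        \<longrightarrow> (\<Sum>l\<in>D. \<bar>k (Sup l) - k (Inf l)\<bar>) < e / (2 * (C + 1))"
    using assms(2)[unfolded abs_continuous_on01_def, rule_format, OF e'(2)] by metis
  show "\<exists>d>0. \<forall>D S. D division_of S \<and> S \<subseteq> {0..1} \<and> (\<Sum>k\<in>D. Sup k - Inf k) < d
        \<longrightarrow> (\<Sum>k\<in>D. \<bar>f (Sup k) - f (Inf k)\<bar>) < e"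
  proof (intro exI[of _ "min d1 d2"] conjI allI impI)
    fix D S assume D: "D division_of S \<and> S \<subseteq> {0..1} \<and> (\<Sum>k\<in>D. Sup k - Inf k) < min d1 d2"
    let ?H = "\<Sum>k\<in>D. \<bar>h (Sup k) - h (Inf k)\<bar>" and ?K = "\<Sum>l\<in>D. \<bar>k (Sup l) - k (Inf l)\<bar>"
    have HK: "?H < e / (2 * (A + 1))" "?K < e / (2 * (C + 1))" using d1(2) d2(2) D by auto
    have nn: "0 \<le> ?H" "0 \<le> ?K" by (auto intro: sum_nonneg)
    have "(\<Sum>k\<in>D. \<bar>f (Sup k) - f (Inf k)\<bar>)
        \<le> (\<Sum>l\<in>D. A * \<bar>h (Sup l) - h (Inf l)\<bar> + C * \<bar>k (Sup l) - k (Inf l)\<bar>)"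
    proof (rule sum_mono)
      fix l assume l: "l \<in> D"
      then obtain a b where ab: "l = cbox a b" "l \<noteq> {}" "l \<subseteq> {0..1}"
        using D division_ofD(2-4)[of D S l] by (metis order_trans)
      then have "a \<le> b" "0 \<le> a" "b \<le> 1" by (auto simp: cbox_interval)
      then show "\<bar>f (Sup l) - f (Inf l)\<bar> \<le> A * \<bar>h (Sup l) - h (Inf l)\<bar> + C * \<bar>k (Sup l) - k (Inf l)\<bar>"
        using f[of a b] ab(1) by (simp add: cbox_interval)
    qed
    also have "\<dots> = A * ?H + C * ?K" by (simp add: sum.distrib sum_distrib_left)
    also have "\<dots> \<le> (A + 1) * ?H + (C + 1) * ?K" using nn by (simp add: algebra_simps)
    also have "\<dots> < e"
    proof -
      have "(A + 1) * ?H < e / 2" "(C + 1) * ?K < e / 2"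
        using HK AC by (auto simp: field_simps)
      then show ?thesis by linarith
    qed
    finally show "(\<Sum>k\<in>D. \<bar>f (Sup k) - f (Inf k)\<bar>) < e" .
  qed (use d1 d2 in auto)
qed

lemma abs_continuous_on01_ident: "abs_continuous_on01 (\<lambda>x. x)"
  unfolding abs_continuous_on01_def
proof (intro allI impI)
  fix e :: real assume "e > 0"
  show "\<exists>d>0. \<forall>D S. D division_of S \<and> S \<subseteq> {0..1} \<and> (\<Sum>k\<in>D. Sup k - Inf k) < d
        \<longrightarrow> (\<Sum>k\<in>D. \<bar>Sup k - Inf k\<bar>) < e"
  proof (intro exI[of _ e] conjI allI impI)
    fix D S assume D: "D division_of S \<and> S \<subseteq> {0..1::real} \<and> (\<Sum>k\<in>D. Sup k - Inf k) < e"
    have "(\<Sum>k\<in>D. \<bar>Sup k - Inf k\<bar>) = (\<Sum>k\<in>D. Sup k - Inf k)"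
    proof (rule sum.cong[OF refl])
      fix l assume l: "l \<in> D"
      then obtain a b where ab: "l = cbox a b" "l \<noteq> {}"
        using D division_ofD(3,4)[of D S l] by metis
      then show "\<bar>Sup l - Inf l\<bar> = Sup l - Inf l" by (auto simp: cbox_interval)
    qed
    with D show "(\<Sum>k\<in>D. \<bar>Sup k - Inf k\<bar>) < e" by simp
  qed fact
qed

lemma C1_lipschitz:
  fixes f f' :: "real \<Rightarrow> real"
  assumes f: "\<And>x. x \<in> {0..1} \<Longrightarrow> (f has_real_derivative f' x) (at x within {0..1})"
    and f': "continuous_on {0..1} f'"
  obtains C where "C \<ge> 0" "\<And>x y. x \<in> {0..1} \<Longrightarrow> y \<in> {0..1} \<Longrightarrow> \<bar>f y - f x\<bar> \<le> C * \<bar>y - x\<bar>"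
proof -
  have "compact (f' ` {0..1})" using f' by (intro compact_continuous_image) auto
  then obtain C where C: "\<And>x. x \<in> {0..1} \<Longrightarrow> \<bar>f' x\<bar> \<le> C"
    using compact_imp_bounded bounded_iff by (metis imageI real_norm_def)
  have "\<bar>f y - f x\<bar> \<le> C * \<bar>y - x\<bar>" if "x \<in> {0..1}" "y \<in> {0..1}" for x y
    using field_differentiable_bound[of "{0..1}" f f' C y x] f C that by auto
  then show thesis using C[of 0] by (intro that[of C]) auto
qed

lemma abs_continuous_on01_C1:
  fixes f f' :: "real \<Rightarrow> real"
  assumes f: "\<And>x. x \<in> {0..1} \<Longrightarrow> (f has_real_derivative f' x) (at x within {0..1})"
    and f': "continuous_on {0..1} f'"
  shows "abs_continuous_on01 f"
proof -
  obtain C where C: "C \<ge> 0" "\<And>x y. x \<in> {0..1} \<Longrightarrow> y \<in> {0..1} \<Longrightarrow> \<bar>f y - f x\<bar> \<le> C * \<bar>y - x\<bar>"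
    using C1_lipschitz[OF f f'] by blast
  show ?thesis
    by (rule abs_continuous_on01_dominated[OF abs_continuous_on01_ident abs_continuous_on01_ident, of f C 0])
      (use C(1) C(2)[of x y for x y] in \<open>simp_all del: abs_of_nonneg\<close>)
qed

lemma abs_continuous_on01_mult_C1:
  fixes w w' h :: "real \<Rightarrow> real"
  assumes w: "\<And>x. x \<in> {0..1} \<Longrightarrow> (w has_real_derivative w' x) (at x within {0..1})"
    and w': "continuous_on {0..1} w'" and h: "abs_continuous_on01 h"
  shows "abs_continuous_on01 (\<lambda>x. w x * h x)"
proof -
  obtain C where C: "C \<ge> 0" "\<And>x y. x \<in> {0..1} \<Longrightarrow> y \<in> {0..1} \<Longrightarrow> \<bar>w y - w x\<bar> \<le> C * \<bar>y - x\<bar>"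
    using C1_lipschitz[OF w w'] by blast
  have "continuous_on {0..1} w" using w by (meson DERIV_continuous_on)
  then have "compact (w ` {0..1})" by (intro compact_continuous_image) auto
  then obtain A where A: "\<And>x. x \<in> {0..1} \<Longrightarrow> \<bar>w x\<bar> \<le> A"
    using compact_imp_bounded bounded_iff by (metis imageI real_norm_def)
  have "compact (h ` {0..1})"
    using abs_continuous_on01_continuous[OF h] by (intro compact_continuous_image) auto
  then obtain E where E: "\<And>x. x \<in> {0..1} \<Longrightarrow> \<bar>h x\<bar> \<le> E"
    using compact_imp_bounded bounded_iff by (metis imageI real_norm_def)
  have "\<bar>w y * h y - w x * h x\<bar> \<le> A * \<bar>h y - h x\<bar> + (E * C) * \<bar>y - x\<bar>" if "0 \<le> x" "x \<le> y" "y \<le> 1" for x y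
  proof -
    have "w y * h y - w x * h x = w y * (h y - h x) + h x * (w y - w x)" by (simp add: algebra_simps)
    then have "\<bar>w y * h y - w x * h x\<bar> \<le> \<bar>w y\<bar> * \<bar>h y - h x\<bar> + \<bar>h x\<bar> * \<bar>w y - w x\<bar>"
      by (metis abs_mult abs_triangle_ineq)
    also have "\<dots> \<le> A * \<bar>h y - h x\<bar> + E * (C * \<bar>y - x\<bar>)"
      using A[of y] E[of x] C(2)[of x y] that A[of 0] E[of 0]
      by (intro add_mono mult_mono) auto
    finally show ?thesis by (simp add: mult.assoc)
  qed
  then show ?thesis
    using A[of 0] E[of 0] C(1)
    by (intro abs_continuous_on01_dominated[OF h abs_continuous_on01_ident, of _ A "E * C"]) auto
qed

section \<open>Integration by parts for the Stieltjes integral\<close>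

lemma tagged_division_interval:
  assumes "p tagged_division_of {a..b::real}" "(t, k) \<in> p"
  shows "k = {Inf k..Sup k}" "Inf k \<le> t" "t \<le> Sup k" "a \<le> Inf k" "Sup k \<le> b"
proof -
  obtain x y where k: "k = {x..y}" using tagged_division_ofD(4)[OF assms] by (auto simp: cbox_interval)
  have "t \<in> k" "k \<subseteq> {a..b}" using tagged_division_ofD(2,3)[OF assms] by auto
  then show "k = {Inf k..Sup k}" "Inf k \<le> t" "t \<le> Sup k" "a \<le> Inf k" "Sup k \<le> b"
    by (auto simp: k)
qed

definition lower_parts :: "(real \<times> real set) set \<Rightarrow> (real \<times> real set) set" where
  "lower_parts p = (\<lambda>(t, k). (Inf k, {Inf k..t})) ` p"

definition upper_parts :: "(real \<times> real set) set \<Rightarrow> (real \<times> real set) set" where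
  "upper_parts p = (\<lambda>(t, k). (Sup k, {t..Sup k})) ` p"

context
  fixes p :: "(real \<times> real set) set" and a b :: real
  assumes p: "p tagged_division_of {a..b}"
begin

lemma tagged_division_split_at_tags: "lower_parts p \<union> upper_parts p tagged_division_of {a..b}"
proof (rule tagged_division_ofI)
  note int = tagged_division_interval[OF p]
  show "finite (lower_parts p \<union> upper_parts p)"
    using tagged_division_ofD(1)[OF p] by (simp add: lower_parts_def upper_parts_def)
  fix s l assume sl: "(s, l) \<in> lower_parts p \<union> upper_parts p"
  have parts: "\<exists>t k. (t, k) \<in> p \<and> (s = Inf k \<and> l = {Inf k..t} \<or> s = Sup k \<and> l = {t..Sup k})"
    if "(s, l) \<in> lower_parts p \<union> upper_parts p" for s l
    using that by (auto simp: lower_parts_def upper_parts_def)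
  obtain t k where tk: "(t, k) \<in> p" "s = Inf k \<and> l = {Inf k..t} \<or> s = Sup k \<and> l = {t..Sup k}"
    using parts[OF sl] by blast
  show "s \<in> l" "l \<subseteq> {a..b}" "\<exists>a b. l = cbox a b"
    using tk int(2-5)[OF tk(1)] by (auto simp: cbox_interval)
  fix s' l' assume sl': "(s', l') \<in> lower_parts p \<union> upper_parts p" "(s, l) \<noteq> (s', l')"
  obtain t' k' where tk': "(t', k') \<in> p" "s' = Inf k' \<and> l' = {Inf k'..t'} \<or> s' = Sup k' \<and> l' = {t'..Sup k'}"
    using parts[OF sl'(1)] by blast
  show "interior l \<inter> interior l' = {}"
  proof (cases "(t, k) = (t', k')")
    case True
    then show ?thesis using tk tk' sl'(2) int(2-5)[OF tk(1)] by auto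
  next
    case False
    have "l \<subseteq> {Inf k..Sup k}" "l' \<subseteq> {Inf k'..Sup k'}"
      using tk(2) tk'(2) int(2,3)[OF tk(1)] int(2,3)[OF tk'(1)] by auto
    then have "l \<subseteq> k" "l' \<subseteq> k'" using int(1)[OF tk(1)] int(1)[OF tk'(1)] by auto
    then have "interior l \<subseteq> interior k" "interior l' \<subseteq> interior k'" by (simp_all only: interior_mono)
    then show ?thesis using tagged_division_ofD(5)[OF p tk(1) tk'(1) False] by blast
  qed
next
  note int = tagged_division_interval[OF p]
  show "\<Union> {l. \<exists>s. (s, l) \<in> lower_parts p \<union> upper_parts p} = {a..b}"
  proof (intro equalityI subsetI)
    fix y assume "y \<in> \<Union> {l. \<exists>s. (s, l) \<in> lower_parts p \<union> upper_parts p}"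
    then obtain t k where "(t, k) \<in> p" "y \<in> {Inf k..t} \<or> y \<in> {t..Sup k}"
      by (auto simp: lower_parts_def upper_parts_def)
    then show "y \<in> {a..b}" using int(2-5)[of t k] by auto
  next
    fix y assume "y \<in> {a..b}"
    then obtain t k where tk: "(t, k) \<in> p" "y \<in> k"
      using tagged_division_ofD(6)[OF p] by blast
    then have "y \<in> {Inf k..t} \<or> y \<in> {t..Sup k}" using int(1)[OF tk(1)] by (metis atLeastAtMost_iff nle_le)
    then show "y \<in> \<Union> {l. \<exists>s. (s, l) \<in> lower_parts p \<union> upper_parts p}"
      using tk(1) by (force simp: lower_parts_def upper_parts_def)
  qed
qed

text \<open>Since the parts form sets, equal parts of different members of \<open>p\<close>, or a
  lower and an upper part, could merge and be counted once. A common part of two different members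
  that has positive length would make their interiors overlap, and a lower part equal to an upper
  part has length zero; so only zero terms merge.\<close>

lemma sum_split_at_tags:
  fixes X w :: "real \<Rightarrow> real"
  shows "(\<Sum>(s, l)\<in>lower_parts p \<union> upper_parts p. X s * (w (Sup l) - w (Inf l)))
    = (\<Sum>(t, k)\<in>p. X (Inf k) * (w t - w (Inf k)) + X (Sup k) * (w (Sup k) - w t))"
proof -
  note int = tagged_division_interval[OF p]
  let ?g = "\<lambda>(s, l). X s * (w (Sup l) - w (Inf l))"
  have fin: "finite p" using tagged_division_ofD(1)[OF p] .
  have overlap: "False" if "(t, k) \<in> p" "(t', k') \<in> p" "(t, k) \<noteq> (t', k')"
     "x < y" "{x..y} \<subseteq> k" "{x..y} \<subseteq> k'" for t k t' k' x y
  proof -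
    have "interior {x..y} \<subseteq> interior k \<inter> interior k'" using that(5,6) by (simp only: interior_mono le_inf_iff)
    then show False using tagged_division_ofD(5)[OF p that(1-3)] that(4) by auto
  qed
  have L: "sum ?g (lower_parts p) = (\<Sum>(t, k)\<in>p. X (Inf k) * (w t - w (Inf k)))"
  proof -
    have "sum ?g (lower_parts p) = (\<Sum>q\<in>p. ?g (case q of (t, k) \<Rightarrow> (Inf k, {Inf k..t})))"
      unfolding lower_parts_def
    proof (subst sum.reindex_nontrivial[OF fin])
      fix q q' assume q: "q \<in> p" "q' \<in> p" "q \<noteq> q'"
        "(case q of (t, k) \<Rightarrow> (Inf k, {Inf k..t})) = (case q' of (t, k) \<Rightarrow> (Inf k, {Inf k..t}))"
      obtain t k t' k' where eq: "q = (t, k)" "q' = (t', k')" by fastforce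
      have i: "Inf k = Inf k'" "t = t'"
        using q int(2)[of t k] int(2)[of t' k'] by (auto simp: eq Icc_eq_Icc)
      have "\<not> Inf k < t"
        using overlap[of t k t' k' "Inf k" t] q i int[of t k] int[of t' k'] unfolding eq
        by (metis atLeastatMost_subset_iff order_refl)
      then have "Inf k = t" using int(2)[of t k] q eq by force
      then show "?g (case q of (t, k) \<Rightarrow> (Inf k, {Inf k..t})) = 0" by (simp add: eq)
    qed (simp add: o_def)
    also have "\<dots> = (\<Sum>(t, k)\<in>p. X (Inf k) * (w t - w (Inf k)))"
      by (intro sum.cong refl) (use int(2,3) in \<open>auto simp: cbox_interval\<close>)
    finally show ?thesis .
  qed
  have U: "sum ?g (upper_parts p) = (\<Sum>(t, k)\<in>p. X (Sup k) * (w (Sup k) - w t))"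
  proof -
    have "sum ?g (upper_parts p) = (\<Sum>q\<in>p. ?g (case q of (t, k) \<Rightarrow> (Sup k, {t..Sup k})))"
      unfolding upper_parts_def
    proof (subst sum.reindex_nontrivial[OF fin])
      fix q q' assume q: "q \<in> p" "q' \<in> p" "q \<noteq> q'"
        "(case q of (t, k) \<Rightarrow> (Sup k, {t..Sup k})) = (case q' of (t, k) \<Rightarrow> (Sup k, {t..Sup k}))"
      obtain t k t' k' where eq: "q = (t, k)" "q' = (t', k')" by fastforce
      have i: "Sup k = Sup k'" "t = t'"
        using q int(3)[of t k] int(3)[of t' k'] by (auto simp: eq Icc_eq_Icc)
      have "\<not> t < Sup k"
        using overlap[of t k t' k' t "Sup k"] q i int[of t k] int[of t' k'] unfolding eq
        by (metis atLeastatMost_subset_iff order_refl)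
      then have "Sup k = t" using int(3)[of t k] q eq by force
      then show "?g (case q of (t, k) \<Rightarrow> (Sup k, {t..Sup k})) = 0" by (simp add: eq)
    qed (simp add: o_def)
    also have "\<dots> = (\<Sum>(t, k)\<in>p. X (Sup k) * (w (Sup k) - w t))"
      by (intro sum.cong refl) (use int(2,3) in \<open>auto simp: cbox_interval\<close>)
    finally show ?thesis .
  qed
  have "sum ?g (lower_parts p \<union> upper_parts p) = sum ?g (lower_parts p) + sum ?g (upper_parts p)"
  proof (rule sum.union_inter_neutral)
    show "finite (lower_parts p)" "finite (upper_parts p)" using fin by (auto simp: lower_parts_def upper_parts_def)
    show "\<forall>x\<in>lower_parts p \<inter> upper_parts p. ?g x = 0"
    proof
      fix x assume "x \<in> lower_parts p \<inter> upper_parts p"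
      then obtain t k t' k' where tk: "(t, k) \<in> p" "(t', k') \<in> p" "x = (Inf k, {Inf k..t})"
        "Inf k = Sup k'" "{Inf k..t} = {t'..Sup k'}"
        unfolding lower_parts_def upper_parts_def by auto
      then have "t = Inf k" using int(2)[OF tk(1)] int(3)[OF tk(2)] by (auto simp: Icc_eq_Icc)
      then show "?g x = 0" by (simp add: tk(3))
    qed
  qed
  then show ?thesis unfolding L U by (simp add: sum.distrib[symmetric] case_prod_beta)
qed

end


text \<open>Splitting every interval of a tagged division at its tag and taking the endpoints as the new
  tags exchanges the roles of integrand and integrator.\<close>

lemma stieltjes_integral_by_parts:
  fixes X w D :: "real \<Rightarrow> real"
  assumes st: "has_stieltjes_integral01 X w I"
    and w: "\<And>t. t \<in> {0..1} \<Longrightarrow> \<bar>w t\<bar> \<le> M"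
    and D: "\<And>t. t \<in> {0..1} \<Longrightarrow> t \<noteq> c \<Longrightarrow> (X has_real_derivative D t) (at t within {0..1})"
    and lip: "d0 > 0" "\<And>y. y \<in> {0..1} \<Longrightarrow> \<bar>y - c\<bar> < d0 \<Longrightarrow> \<bar>X y - X c - D c * (y - c)\<bar> \<le> L * \<bar>y - c\<bar>"
  shows "((\<lambda>t. w t * D t) has_integral (X 1 * w 1 - X 0 * w 0 - I)) {0..1}"
  unfolding has_integral_real
proof (intro allI impI)
  fix e :: real assume "e > 0"
  have M: "M \<ge> 0" using w[of 0] by auto
  \<comment> \<open>Chosen so that the two error terms, each at most \<open>M * \<eta>\<close>, use
    half of \<open>e\<close>; another quarter goes to the Stieltjes sum.\<close>
  define \<eta> where "\<eta> = e / (4 * (M + 1))"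
  have \<eta>: "\<eta> > 0" "M * \<eta> \<le> e / 4" using \<open>e > 0\<close> M by (auto simp: \<eta>_def field_simps)
  \<comment> \<open>At \<open>c\<close> the linear approximation is off by up to \<open>|L|\<close>
    times the length, which does not become small relative to the length. But a function supported
    at one point has integral zero, so a suitable gauge makes the total length of intervals tagged
    by \<open>c\<close> negligible.\<close>
  have "((\<lambda>t. if t = c then \<bar>L\<bar> else 0) has_integral 0) {0..1::real}"
    by (rule has_integral_spike_finite[of "{c}" _ _ "\<lambda>_. 0"]) auto
  from this[unfolded has_integral_real, rule_format, OF \<eta>(1)]
  obtain \<gamma>0 where \<gamma>0: "gauge \<gamma>0" "\<And>p. p tagged_division_of {0..1} \<Longrightarrow> \<gamma>0 fine p \<Longrightarrow>
      \<bar>\<Sum>(t, k)\<in>p. measure lborel k * (if t = c then \<bar>L\<bar> else 0)\<bar> < \<eta>"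
    by auto
  obtain d where d: "d > 0" "\<And>p. p tagged_division_of {0..1} \<Longrightarrow> (\<lambda>x. ball x d) fine p \<Longrightarrow>
      \<bar>(\<Sum>(x, k)\<in>p. X x * (w (Sup k) - w (Inf k))) - I\<bar> < e / 4"
    using st[unfolded has_stieltjes_integral01_def, rule_format, of "e / 4"] \<open>e > 0\<close> by auto
  have "\<exists>r>0. \<forall>y\<in>{0..1}. \<bar>y - t\<bar> < r \<longrightarrow>
      \<bar>X y - X t - D t * (y - t)\<bar> \<le> (\<eta> + (if t = c then \<bar>L\<bar> else 0)) * \<bar>y - t\<bar>"
    if t: "t \<in> {0..1}" for t
  proof (cases "t = c")
    case True
    have "\<bar>X y - X t - D t * (y - t)\<bar> \<le> (\<eta> + (if t = c then \<bar>L\<bar> else 0)) * \<bar>y - t\<bar>"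
      if "y \<in> {0..1}" "\<bar>y - t\<bar> < d0" for y
    proof -
      have "\<bar>X y - X t - D t * (y - t)\<bar> \<le> L * \<bar>y - t\<bar>" using lip(2)[of y] that True by simp
      also have "\<dots> \<le> (\<eta> + (if t = c then \<bar>L\<bar> else 0)) * \<bar>y - t\<bar>"
        using \<eta>(1) True by (intro mult_right_mono) auto
      finally show ?thesis .
    qed
    then show ?thesis using lip(1) by blast
  next
    case False
    have "(X has_derivative (*) (D t)) (at t within {0..1})"
      using D[OF t False] by (simp add: has_field_derivative_def)
    then obtain r where r: "r > 0" "\<forall>y\<in>{0..1}. norm (y - t) < r \<longrightarrow>
        norm (X y - X t - D t * (y - t)) \<le> \<eta> * norm (y - t)"
      using \<eta>(1) unfolding has_derivative_within_alt by blast
    then show ?thesis using False by auto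
  qed
  then obtain r where r: "\<And>t. t \<in> {0..1} \<Longrightarrow> r t > 0"
    "\<And>t y. t \<in> {0..1} \<Longrightarrow> y \<in> {0..1} \<Longrightarrow> \<bar>y - t\<bar> < r t \<Longrightarrow>
      \<bar>X y - X t - D t * (y - t)\<bar> \<le> (\<eta> + (if t = c then \<bar>L\<bar> else 0)) * \<bar>y - t\<bar>"
    by metis
  \<comment> \<open>\<open>\<gamma>0\<close> controls the exceptional point, \<open>d\<close> keeps
    the division split at the tags fine enough for the Stieltjes sum, and \<open>r t\<close>
    provides the linear approximation at the tag.\<close>
  define \<gamma> where "\<gamma> = (\<lambda>t. \<gamma>0 t \<inter> (ball t d \<inter> ball t (if t \<in> {0..1} then r t else 1)))"
  have gauge: "gauge \<gamma>" unfolding \<gamma>_def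
    using \<gamma>0(1) d(1) r(1) by (intro gauge_Int gauge_ball_dependent) (auto simp: gauge_def)
  have sum: "norm ((\<Sum>(t, k)\<in>p. measure lborel k *\<^sub>R (w t * D t)) - (X 1 * w 1 - X 0 * w 0 - I)) < e"
    if p: "p tagged_division_of {0..1}" "\<gamma> fine p" for p
  proof -
    note int = tagged_division_interval[OF p(1)]
    have ct: "measure lborel k = Sup k - Inf k" if "(t, k) \<in> p" for t k
      using int[OF that] by (metis content_real order_trans)
    have near: "\<bar>Inf k - t\<bar> < d" "\<bar>Sup k - t\<bar> < d" "\<bar>Inf k - t\<bar> < r t" "\<bar>Sup k - t\<bar> < r t" "k \<subseteq> \<gamma>0 t"
      if "(t, k) \<in> p" for t k
    proof -
      have "k \<subseteq> \<gamma> t" using p(2) that by (auto simp: fine_def)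
      moreover have "Inf k \<in> {Inf k..Sup k}" "Sup k \<in> {Inf k..Sup k}" using int(2,3)[OF that] by auto
      then have "Inf k \<in> k" "Sup k \<in> k" using int(1)[OF that] by metis+
      moreover have "t \<in> {0..1}" using int(2-5)[OF that] by auto
      ultimately show "\<bar>Inf k - t\<bar> < d" "\<bar>Sup k - t\<bar> < d" "\<bar>Inf k - t\<bar> < r t" "\<bar>Sup k - t\<bar> < r t" "k \<subseteq> \<gamma>0 t"
        by (auto simp: \<gamma>_def dist_real_def subset_iff abs_minus_commute)
    qed
    let ?q = "lower_parts p \<union> upper_parts p"
    have "(\<lambda>x. ball x d) fine ?q"
      unfolding fine_def
    proof (clarify)
      fix s l y assume sl: "(s, l) \<in> ?q" and y: "y \<in> l"
      then obtain t k where tk: "(t, k) \<in> p" "s = Inf k \<and> l = {Inf k..t} \<or> s = Sup k \<and> l = {t..Sup k}"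
        by (auto simp: lower_parts_def upper_parts_def)
      then show "y \<in> ball s d" using near(1,2)[OF tk(1)] y by (auto simp: dist_real_def)
    qed
    then have S: "\<bar>(\<Sum>(x, k)\<in>?q. X x * (w (Sup k) - w (Inf k))) - I\<bar> < e / 4"
      by (rule d(2)[OF tagged_division_split_at_tags[OF p(1)]])
    \<comment> \<open>Summation by parts on one interval: the two split terms equal the increment of
      \<open>X w\<close> minus \<open>w t\<close> times the increment of \<open>X\<close>. The
      increments of \<open>X w\<close> telescope.\<close>
    have "(\<Sum>(x, k)\<in>?q. X x * (w (Sup k) - w (Inf k)))
        = (\<Sum>(t, k)\<in>p. (X (Sup k) * w (Sup k) - X (Inf k) * w (Inf k)) - w t * (X (Sup k) - X (Inf k)))"
      unfolding sum_split_at_tags[OF p(1)] by (intro sum.cong refl) (auto simp: algebra_simps)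
    also have "\<dots> = (\<Sum>(t, k)\<in>p. X (Sup k) * w (Sup k) - X (Inf k) * w (Inf k))
        - (\<Sum>(t, k)\<in>p. w t * (X (Sup k) - X (Inf k)))"
      by (simp add: sum_subtractf case_prod_beta)
    also have "(\<Sum>(t, k)\<in>p. X (Sup k) * w (Sup k) - X (Inf k) * w (Inf k)) = X 1 * w 1 - X 0 * w 0"
      using additive_tagged_division_1[OF _ p(1), of "\<lambda>x. X x * w x"] by simp
    finally have S': "(\<Sum>(x, k)\<in>?q. X x * (w (Sup k) - w (Inf k)))
        = X 1 * w 1 - X 0 * w 0 - (\<Sum>(t, k)\<in>p. w t * (X (Sup k) - X (Inf k)))" .
    have "\<bar>(\<Sum>(t, k)\<in>p. measure lborel k * (w t * D t)) - (\<Sum>(t, k)\<in>p. w t * (X (Sup k) - X (Inf k)))\<bar>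
        = \<bar>\<Sum>(t, k)\<in>p. w t * (measure lborel k * D t - (X (Sup k) - X (Inf k)))\<bar>"
      by (simp add: sum_subtractf[symmetric] case_prod_beta algebra_simps)
    also have "\<dots> \<le> (\<Sum>(t, k)\<in>p. M * (measure lborel k * \<eta> + measure lborel k * (if t = c then \<bar>L\<bar> else 0)))"
    proof (rule order_trans[OF sum_abs], rule sum_mono, clarify)
      fix t k assume tk: "(t, k) \<in> p"
      have t01: "t \<in> {0..1}" "Inf k \<in> {0..1}" "Sup k \<in> {0..1}"
        using int(2-5)[OF tk] by auto
      let ?z = "\<eta> + (if t = c then \<bar>L\<bar> else 0)"
      \<comment> \<open>The straddle argument: the error is split at the tag into two linear
        approximation errors, whose distances to the tag add up to the length of
        \<open>k\<close>.\<close>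
      have "measure lborel k * D t - (X (Sup k) - X (Inf k))
          = (X (Inf k) - X t - D t * (Inf k - t)) - (X (Sup k) - X t - D t * (Sup k - t))"
        unfolding ct[OF tk] by (simp add: algebra_simps)
      then have "\<bar>measure lborel k * D t - (X (Sup k) - X (Inf k))\<bar> \<le> ?z * \<bar>Inf k - t\<bar> + ?z * \<bar>Sup k - t\<bar>"
        using r(2)[OF t01(1,2)] r(2)[OF t01(1,3)] near(3,4)[OF tk] by linarith
      also have "\<dots> = ?z * (\<bar>Inf k - t\<bar> + \<bar>Sup k - t\<bar>)" by (simp only: distrib_left)
      also have "\<bar>Inf k - t\<bar> + \<bar>Sup k - t\<bar> = measure lborel k" using ct[OF tk] int(2,3)[OF tk] by simp
      finally have E: "\<bar>measure lborel k * D t - (X (Sup k) - X (Inf k))\<bar> \<le> ?z * measure lborel k" .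
      have "\<bar>w t * (measure lborel k * D t - (X (Sup k) - X (Inf k)))\<bar> \<le> M * (?z * measure lborel k)"
        unfolding abs_mult using w[OF t01(1)] E M by (intro mult_mono) auto
      then show "\<bar>w t * (measure lborel k * D t - (X (Sup k) - X (Inf k)))\<bar>
          \<le> M * (measure lborel k * \<eta> + measure lborel k * (if t = c then \<bar>L\<bar> else 0))"
        by (simp only: distrib_left distrib_right mult.commute)
    qed
    also have "\<dots> = M * ((\<Sum>(t, k)\<in>p. measure lborel k) * \<eta> + (\<Sum>(t, k)\<in>p. measure lborel k * (if t = c then \<bar>L\<bar> else 0)))"
      by (simp add: case_prod_unfold sum.distrib sum_distrib_left sum_distrib_right distrib_left)
    also have "(\<Sum>(t, k)\<in>p. measure lborel k) = 1"
      using additive_content_tagged_division[of p 0 1] p(1) by (simp add: cbox_interval)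
    also have "M * (1 * \<eta> + (\<Sum>(t, k)\<in>p. measure lborel k * (if t = c then \<bar>L\<bar> else 0))) \<le> M * (\<eta> + \<eta>)"
    proof -
      have "\<gamma>0 fine p" using near(5) by (auto simp: fine_def)
      then show ?thesis using \<gamma>0(2)[OF p(1)] M by (intro mult_left_mono) linarith+
    qed
    also have "\<dots> \<le> e / 2" using \<eta>(2) by (simp add: distrib_left)
    finally show ?thesis using S \<open>e > 0\<close> unfolding S' real_norm_def real_scaleR_def by linarith
  qed
  show "\<exists>\<gamma>. gauge \<gamma> \<and> (\<forall>p. p tagged_division_of {0..1} \<and> \<gamma> fine p \<longrightarrow>
     norm ((\<Sum>(t, k)\<in>p. measure lborel k *\<^sub>R (w t * D t)) - (X 1 * w 1 - X 0 * w 0 - I)) < e)"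
    by (intro exI[of _ \<gamma>] conjI allI impI gauge, elim conjE, rule sum)
qed

section \<open>The integral equation along a path\<close>

text \<open>The affine term \<open>m + n * x\<close> treats both equations at once:
  \<open>m = 0\<close>, \<open>n = 1\<close> for \<open>u\<close>, and \<open>m = 1\<close>,
  \<open>n = -1\<close> for \<open>v\<close>.\<close>

locale sde_path =
  fixes b u u' :: "real \<Rightarrow> real" and m n :: real
  assumes b: "continuous_on {0..1} b"
    and u: "\<And>x. x \<in> {0..1} \<Longrightarrow> (u has_real_derivative u' x) (at x within {0..1})"
    and sde: "\<And>x. x \<in> {0..1} \<Longrightarrow> \<exists>I. has_stieltjes_integral01 (\<lambda>y. K x y * u y) b I \<and> u x - (m + n * x) = - I"
begin

lemma u_continuous: "continuous_on {0..1} u"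
  using u by (rule DERIV_continuous_on)

lemma b_bounded: obtains M where "\<And>t. t \<in> {0..1} \<Longrightarrow> \<bar>b t\<bar> \<le> M"
proof -
  have "compact (b ` {0..1})" using b by (intro compact_continuous_image) auto
  then show thesis using that compact_imp_bounded bounded_iff by (metis imageI real_norm_def)
qed

lemma u_boundary:
  assumes "x = 0 \<or> x = 1"
  shows "u x = m + n * x"
proof -
  have K0: "K x y = 0" if "y \<in> {0..1}" for y using assms that by (auto simp: K_def)
  obtain I where I: "has_stieltjes_integral01 (\<lambda>y. K x y * u y) b I" "u x - (m + n * x) = - I"
    using sde[of x] assms by auto
  obtain M where M: "\<And>t. t \<in> {0..1} \<Longrightarrow> \<bar>b t\<bar> \<le> M" using b_bounded by blast
  have "((\<lambda>t. b t * 0) has_integral (K x 1 * u 1 * b 1 - K x 0 * u 0 * b 0 - I)) {0..1}"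
  \<comment> \<open>The integrand vanishes identically on the interval; \<open>c = 2\<close> with
    radius 1 places the exceptional point where its condition is vacuous.\<close>
  proof (rule stieltjes_integral_by_parts[OF I(1) M, where c = 2 and ?d0.0 = 1 and L = 0])
    fix t :: real assume t: "t \<in> {0..1}"
    show "((\<lambda>y. K x y * u y) has_real_derivative 0) (at t within {0..1})"
      by (rule has_field_derivative_transform_within[where f="\<lambda>_. 0" and d=1]) (use t K0 in auto)
  qed (auto simp: K0)
  then have "I = 0" using K0 has_integral_unique[OF _ has_integral_0] by fastforce
  then show ?thesis using I by simp
qed

text \<open>To the left of \<open>x\<close> the integrand \<open>K x t * u t\<close> is
  \<open>1 - x\<close> times \<open>t * u t\<close>, to the right it is \<open>x\<close> times
  \<open>(1 - t) * u t\<close>. The functions \<open>lo\<close> and \<open>up\<close> are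
  \<open>b\<close> times the derivatives of these two \<open>x\<close>-free factors.\<close>

definition lo :: "real \<Rightarrow> real" where "lo t = b t * (u t + t * u' t)"
definition up :: "real \<Rightarrow> real" where "up t = b t * ((1 - t) * u' t - u t)"

text \<open>Integration by parts with integrand \<open>K x y * u y\<close>, whose boundary values
  vanish. Its kink at \<open>y = x\<close> is the exceptional point.\<close>

lemma green_representation:
  assumes x: "0 < x" "x < 1"
  shows "((\<lambda>t. b t * (if t \<le> x then (1 - x) * (u t + t * u' t) else x * ((1 - t) * u' t - u t)))
    has_integral (u x - (m + n * x))) {0..1}"
proof -
  let ?X = "\<lambda>y. K x y * u y"
  let ?D = "\<lambda>t. if t \<le> x then (1 - x) * (u t + t * u' t) else x * ((1 - t) * u' t - u t)"
  obtain I where I: "has_stieltjes_integral01 ?X b I" "u x - (m + n * x) = - I"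
    using sde[of x] x by auto
  obtain M where M: "\<And>t. t \<in> {0..1} \<Longrightarrow> \<bar>b t\<bar> \<le> M" using b_bounded by blast
  have dl: "((\<lambda>y. y * (1 - x) * u y) has_real_derivative (1 - x) * (u t + t * u' t)) (at t within {0..1})"
    if "t \<in> {0..1}" for t
    by (rule derivative_eq_intros u[OF that] refl)+ (simp add: algebra_simps)
  have du: "((\<lambda>y. x * (1 - y) * u y) has_real_derivative x * ((1 - t) * u' t - u t)) (at t within {0..1})"
    if "t \<in> {0..1}" for t
    by (rule derivative_eq_intros u[OF that] refl)+ (simp add: algebra_simps)
  have approx: "\<exists>r>0. \<forall>y\<in>{0..1}. \<bar>y - x\<bar> < r \<longrightarrow> \<bar>f y - f x - d * (y - x)\<bar> \<le> \<bar>y - x\<bar>"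
    if "(f has_real_derivative d) (at x within {0..1})" for f d
    using that[unfolded has_field_derivative_def has_derivative_within_alt, THEN conjunct2, rule_format, of 1]
    by simp
  have x01: "x \<in> {0..1}" using x by auto
  obtain r1 where r1: "r1 > 0" "\<And>y. y \<in> {0..1} \<Longrightarrow> \<bar>y - x\<bar> < r1 \<Longrightarrow>
      \<bar>y * (1 - x) * u y - x * (1 - x) * u x - (1 - x) * (u x + x * u' x) * (y - x)\<bar> \<le> \<bar>y - x\<bar>"
    using approx[OF dl[OF x01]] by blast
  obtain r2 where r2: "r2 > 0" "\<And>y. y \<in> {0..1} \<Longrightarrow> \<bar>y - x\<bar> < r2 \<Longrightarrow>
      \<bar>x * (1 - y) * u y - x * (1 - x) * u x - x * ((1 - x) * u' x - u x) * (y - x)\<bar> \<le> \<bar>y - x\<bar>"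
    using approx[OF du[OF x01]] by blast
  \<comment> \<open>The 1 is the error of either smooth branch; the rest is the jump of the slope at
    the kink, needed to the right of \<open>x\<close> because \<open>?D x\<close> takes the left
    branch.\<close>
  define L where "L = 1 + \<bar>x * ((1 - x) * u' x - u x) - (1 - x) * (u x + x * u' x)\<bar>"
  have "((\<lambda>t. b t * ?D t) has_integral (?X 1 * b 1 - ?X 0 * b 0 - I)) {0..1}"
  proof (rule stieltjes_integral_by_parts[OF I(1) M, where c = x and ?d0.0 = "min r1 r2" and L = L])
    fix t :: real assume t: "t \<in> {0..1}" "t \<noteq> x"
    show "(?X has_real_derivative ?D t) (at t within {0..1})"
    proof (cases "t < x")
      case True
      show ?thesis
        by (rule has_field_derivative_transform_within[where f="\<lambda>y. y * (1 - x) * u y" and d="x - t"])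
          (use t True dl[OF t(1)] in \<open>auto simp: K_def dist_real_def\<close>)
    next
      case False
      show ?thesis
        by (rule has_field_derivative_transform_within[where f="\<lambda>y. x * (1 - y) * u y" and d="t - x"])
          (use t False du[OF t(1)] in \<open>auto simp: K_def dist_real_def\<close>)
    qed
  next
    show "min r1 r2 > 0" using r1 r2 by simp
    fix y :: real assume y: "y \<in> {0..1}" "\<bar>y - x\<bar> < min r1 r2"
    show "\<bar>?X y - ?X x - ?D x * (y - x)\<bar> \<le> L * \<bar>y - x\<bar>"
    proof (cases "y < x")
      case True
      have "\<bar>?X y - ?X x - ?D x * (y - x)\<bar> \<le> 1 * \<bar>y - x\<bar>"
        using r1(2)[OF y(1)] y(2) True by (simp add: K_def mult.commute)
      also have "\<dots> \<le> L * \<bar>y - x\<bar>" by (intro mult_right_mono) (auto simp: L_def)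
      finally show ?thesis .
    next
      case False
      let ?E = "x * ((1 - x) * u' x - u x)"
      have "?X y - ?X x - ?D x * (y - x) = (x * (1 - y) * u y - x * (1 - x) * u x - ?E * (y - x)) + (?E - ?D x) * (y - x)"
        using False by (simp add: K_def left_diff_distrib)
      then have "\<bar>?X y - ?X x - ?D x * (y - x)\<bar> \<le> \<bar>y - x\<bar> + \<bar>?E - ?D x\<bar> * \<bar>y - x\<bar>"
        using r2(2)[OF y(1)] y(2) unfolding abs_mult[symmetric] by linarith
      also have "\<dots> = L * \<bar>y - x\<bar>" by (simp add: L_def distrib_right)
      finally show ?thesis .
    qed
  qed
  moreover have "?X 1 = 0" "?X 0 = 0" using x by (auto simp: K_def)
  ultimately show ?thesis using I(2) by simp
qed

text \<open>For interior \<open>x\<close> the factors \<open>1 - x\<close> and \<open>x\<close> can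
  be cancelled, so integrability of \<open>lo\<close> and \<open>up\<close> comes from the equation
  and not from regularity of \<open>u'\<close>.\<close>

lemma
  assumes x: "0 < x" "x < 1"
  shows integrable_lo: "lo integrable_on {0..x}"
    and integrable_up: "up integrable_on {x..1}"
    and u_eq: "u x = m + n * x + (1 - x) * integral {0..x} lo + x * integral {x..1} up"
proof -
  let ?f = "\<lambda>t. b t * (if t \<le> x then (1 - x) * (u t + t * u' t) else x * ((1 - t) * u' t - u t))"
  have f: "(?f has_integral (u x - (m + n * x))) {0..1}" by (rule green_representation[OF x])
  then have fi: "?f integrable_on {0..1}" by (rule has_integral_integrable)
  have f1: "?f integrable_on {0..x}" using fi x by (intro integrable_subinterval_real[OF fi]) auto
  have f2: "?f integrable_on {x..1}" using fi x by (intro integrable_subinterval_real[OF fi]) auto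
  have "(\<lambda>t. (1 - x) * lo t) integrable_on {0..x}"
    using f1 by (rule integrable_eq) (auto simp: lo_def)
  then show lo: "lo integrable_on {0..x}" using x integrable_on_cmult_left_iff[of "1 - x" lo] by simp
  have "(\<lambda>t. x * up t) integrable_on {x..1}"
    using f2 by (rule integrable_spike[of _ _ "{x}"]) (auto simp: up_def)
  then show up: "up integrable_on {x..1}" using x integrable_on_cmult_left_iff[of x up] by simp
  have "u x - (m + n * x) = integral {0..1} ?f" using f by (simp add: integral_unique)
  also have "\<dots> = integral {0..x} ?f + integral {x..1} ?f"
    using x fi by (intro Henstock_Kurzweil_Integration.integral_combine[symmetric]) auto
  also have "integral {0..x} ?f = integral {0..x} (\<lambda>t. (1 - x) * lo t)"
    by (intro integral_cong) (auto simp: lo_def)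
  also have "integral {x..1} ?f = integral {x..1} (\<lambda>t. x * up t)"
    by (rule integral_spike[of "{x}"]) (auto simp: up_def)
  finally show "u x = m + n * x + (1 - x) * integral {0..x} lo + x * integral {x..1} up" by simp
qed


text \<open>On the open interval this is \<open>u' - b u\<close>. Unlike \<open>u'\<close>, it is again differentiable.\<close>

definition quasi :: "real \<Rightarrow> real" where
  "quasi x = n - integral {0..x} lo + integral {x..1} up"

lemma lo_plus_up: "lo t + up t = b t * u' t"
  by (simp add: lo_def up_def algebra_simps)

lemma integrable_bu':
  assumes "0 < s" "t < 1" shows "(\<lambda>x. b x * u' x) integrable_on {s..t}"
proof (cases "s \<le> t")
  case True
  have "lo integrable_on {s..t}"
    by (rule integrable_subinterval_real[OF integrable_lo[of t]]) (use assms True in auto)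
  moreover have "up integrable_on {s..t}"
    by (rule integrable_subinterval_real[OF integrable_up[of s]]) (use assms True in auto)
  ultimately have "(\<lambda>x. lo x + up x) integrable_on {s..t}" by (rule integrable_add)
  then show ?thesis by (simp add: lo_plus_up)
qed (simp add: integrable_on_empty)

lemma lo_up_increments:
  assumes "0 < x" "x \<le> y" "y < 1"
  shows "integral {0..y} lo = integral {0..x} lo + integral {x..y} lo"
    and "integral {x..1} up = integral {y..1} up + integral {x..y} up"
    and "lo integrable_on {x..y}" "up integrable_on {x..y}"
proof -
  show "integral {0..y} lo = integral {0..x} lo + integral {x..y} lo"
    using assms integrable_lo[of y] by (intro Henstock_Kurzweil_Integration.integral_combine[symmetric]) auto
  have "integral {x..y} up + integral {y..1} up = integral {x..1} up"
    using assms integrable_up[of x] by (intro Henstock_Kurzweil_Integration.integral_combine) auto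
  then show "integral {x..1} up = integral {y..1} up + integral {x..y} up" by simp
  show "lo integrable_on {x..y}"
    by (rule integrable_subinterval_real[OF integrable_lo[of y]]) (use assms in auto)
  show "up integrable_on {x..y}"
    by (rule integrable_subinterval_real[OF integrable_up[of x]]) (use assms in auto)
qed

lemma quasi_increment:
  assumes "0 < x" "x \<le> y" "y < 1"
  shows "quasi y - quasi x = - integral {x..y} (\<lambda>t. b t * u' t)"
  using lo_up_increments[OF assms] integral_add[OF lo_up_increments(3,4)[OF assms]]
  by (simp add: quasi_def lo_plus_up)

lemma quasi_continuous:
  assumes "0 < s" "t < 1"
  shows "continuous_on {s..t} quasi"
proof -
  have "continuous_on {s..t} (\<lambda>x. quasi s - integral {s..x} (\<lambda>t. b t * u' t))"
    using assms by (intro continuous_intros indefinite_integral_continuous_1 integrable_bu')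
  then show ?thesis
    by (rule continuous_on_eq) (use quasi_increment[of s] assms in force)
qed

text \<open>The term with integrand \<open>(t - x) * b t * u' t\<close> cannot be bounded through
  absolute values. The weight \<open>t - x\<close> is monotone and vanishes at \<open>x\<close>, so
  the second mean value theorem extracts the factor \<open>y - x\<close> and leaves an integral of
  \<open>b u'\<close> over a subinterval, which is small by continuity of the indefinite
  integral.\<close>

lemma u_increment:
  assumes x: "0 < x" "x < y" "y < 1"
  obtains \<xi> where "\<xi> \<in> {x..y}"
    "u y - u x = (y - x) * quasi y + integral {x..y} (\<lambda>t. b t * u t)
      + (y - x) * integral {\<xi>..y} (\<lambda>t. b t * u' t)"
proof -
  let ?f = "\<lambda>t. b t * u' t"
  have f: "?f integrable_on {x..y}" using x by (intro integrable_bu') auto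
  obtain \<xi> where \<xi>: "\<xi> \<in> {x..y}"
    "((\<lambda>t. (t - x) * ?f t) has_integral ((x - x) * integral {x..\<xi>} ?f + (y - x) * integral {\<xi>..y} ?f)) {x..y}"
    by (rule second_mean_value_theorem_full[OF f, of "\<lambda>t. t - x"]) (use x in auto)
  have "continuous_on {0..1} (\<lambda>t. b t * u t)" by (intro continuous_intros b u_continuous)
  then have bu: "(\<lambda>t. b t * u t) integrable_on {x..y}"
    using x by (intro integrable_continuous_real) (auto elim: continuous_on_subset)
  have xy: "0 < x" "x \<le> y" "y < 1" using x by auto
  note inc = lo_up_increments[OF xy]
  have "u y - u x = (y - x) * quasi y + ((1 - x) * integral {x..y} lo - x * integral {x..y} up)"
    using u_eq[of x] u_eq[of y] x inc(1,2) by (simp add: quasi_def algebra_simps)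
  also have "(1 - x) * integral {x..y} lo - x * integral {x..y} up
      = integral {x..y} (\<lambda>t. (1 - x) * lo t - x * up t)"
    using inc(3,4) integrable_cmul[of lo "{x..y}" "1 - x"] integrable_cmul[of up "{x..y}" x]
    by (subst integral_diff) auto
  also have "\<dots> = integral {x..y} (\<lambda>t. b t * u t + (t - x) * ?f t)"
    by (intro integral_cong) (simp add: lo_def up_def algebra_simps)
  also have "\<dots> = integral {x..y} (\<lambda>t. b t * u t) + (y - x) * integral {\<xi>..y} ?f"
    using bu \<xi>(2) by (subst integral_add) (auto simp: has_integral_integrable integral_unique)
  finally show thesis using \<xi>(1) that by (simp add: add.assoc)
qed

text \<open>Formal differentiation of \<open>u_eq\<close> gives this, because
  \<open>(1 - x) * lo x - x * up x = b x * u x\<close>. As \<open>lo\<close> and \<open>up\<close>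
  are only known to be gauge integrable, the differentiation is replaced by a limit of difference
  quotients from the right; that suffices since \<open>u' x\<close> is known to exist.\<close>

lemma u'_eq:
  assumes x: "0 < x" "x < 1"
  shows "u' x = quasi x + b x * u x"
proof -
  let ?f = "\<lambda>t. b t * u' t"
  \<comment> \<open>A point strictly between \<open>x\<close> and 1: integrability of
    \<open>b u'\<close> is so far known only on compact parts of the open interval.\<close>
  define z where "z = (x + 1) / 2"
  have z: "x < z" "z < 1" using x by (auto simp: z_def)
  define F where "F = (\<lambda>y. integral {x..y} ?f)"
  have Fc: "continuous_on {x..z} F" unfolding F_def
    using x z by (intro indefinite_integral_continuous_1 integrable_bu') auto
  have Fd: "integral {\<xi>..y} ?f = F y - F \<xi>" if "x \<le> \<xi>" "\<xi> \<le> y" "y \<le> z" for \<xi> y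
  proof -
    have "F \<xi> + integral {\<xi>..y} ?f = F y" unfolding F_def
      using x z that by (intro Henstock_Kurzweil_Integration.integral_combine integrable_bu') auto
    then show ?thesis by simp
  qed
  have ev: "eventually (\<lambda>y. x < y \<and> y < z) (at_right x)"
    using z by (auto simp: eventually_at_right_field)
  have lim_q: "(quasi \<longlongrightarrow> quasi x) (at_right x)"
  proof -
    have "continuous_on {x..z} quasi" using x z by (intro quasi_continuous) auto
    then have "(quasi \<longlongrightarrow> quasi x) (at x within {x..z})" using z by (simp add: continuous_on_def)
    then show ?thesis using z at_within_Icc_at_right[of x z] by simp
  qed
  have lim_b: "((\<lambda>y. integral {x..y} (\<lambda>t. b t * u t) / (y - x)) \<longlongrightarrow> b x * u x) (at_right x)"
  proof -
    have "continuous_on {x..z} (\<lambda>t. b t * u t)"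
      using x z by (intro continuous_intros continuous_on_subset[OF b] continuous_on_subset[OF u_continuous]) auto
    then have "((\<lambda>y. integral {x..y} (\<lambda>t. b t * u t)) has_real_derivative b x * u x) (at x within {x..z})"
      using z by (intro integral_has_real_derivative) auto
    then show ?thesis using z at_within_Icc_at_right[of x z] by (simp add: has_field_derivative_iff)
  qed
  \<comment> \<open>The remainder is exactly the term produced by the second mean value theorem,
    that is, a difference of two values of \<open>F\<close> near \<open>x\<close>.\<close>
  define R where "R = (\<lambda>y. (u y - u x) / (y - x) - quasi y - integral {x..y} (\<lambda>t. b t * u t) / (y - x))"
  have lim_R: "(R \<longlongrightarrow> 0) (at_right x)"
    unfolding tendsto_iff
  proof (intro allI impI)
    fix e :: real assume "e > 0"
    have F0: "F x = 0" by (simp add: F_def)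
    have "(F \<longlongrightarrow> F x) (at_right x)"
      using Fc[unfolded continuous_on_def, rule_format, of x] z at_within_Icc_at_right[of x z] by simp
    then have "eventually (\<lambda>y. dist (F y) 0 < e / 2) (at_right x)"
      unfolding F0 tendsto_iff using \<open>e > 0\<close> by (meson half_gt_zero)
    then obtain d where d: "d > x" "\<And>y. x < y \<Longrightarrow> y < d \<Longrightarrow> \<bar>F y\<bar> < e / 2"
      by (auto simp: eventually_at_right_field dist_real_def)
    have "dist (R y) 0 < e" if y: "x < y" "y < min d z" for y
    proof -
      obtain \<xi> where \<xi>: "\<xi> \<in> {x..y}"
        "u y - u x = (y - x) * quasi y + integral {x..y} (\<lambda>t. b t * u t) + (y - x) * integral {\<xi>..y} ?f"
        by (rule u_increment[of x y]) (use x z y in auto)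
      have "R y = integral {\<xi>..y} ?f"
        using y unfolding R_def \<xi>(2) by (simp add: add_divide_distrib)
      also have "\<dots> = F y - F \<xi>" using \<xi>(1) y by (intro Fd) auto
      finally have "R y = F y - F \<xi>" .
      moreover have "\<bar>F y\<bar> < e / 2" using d y by auto
      moreover have "\<bar>F \<xi>\<bar> < e / 2" using d(2)[of \<xi>] \<xi>(1) y F0 \<open>e > 0\<close> by (cases "\<xi> = x") auto
      ultimately show ?thesis by (simp add: dist_real_def)
    qed
    then show "eventually (\<lambda>y. dist (R y) 0 < e) (at_right x)"
      unfolding eventually_at_right_field using d(1) z by (intro exI[of _ "min d z"]) auto
  qed
  have "((\<lambda>y. R y + quasi y + integral {x..y} (\<lambda>t. b t * u t) / (y - x)) \<longlongrightarrow> 0 + quasi x + b x * u x) (at_right x)"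
    by (intro tendsto_add lim_R lim_q lim_b)
  then have "((\<lambda>y. (u y - u x) / (y - x)) \<longlongrightarrow> quasi x + b x * u x) (at_right x)"
    by (simp add: R_def)
  moreover have "((\<lambda>y. (u y - u x) / (y - x)) \<longlongrightarrow> u' x) (at_right x)"
  proof -
    have "((\<lambda>y. (u y - u x) / (y - x)) \<longlongrightarrow> u' x) (at x within {x..z})"
      using u[of x] x z unfolding has_field_derivative_iff by (auto elim!: tendsto_within_subset)
    then show ?thesis using z at_within_Icc_at_right[of x z] by simp
  qed
  ultimately show ?thesis by (intro tendsto_unique[of "at_right x"]) auto
qed


text \<open>A bootstrap: the formula for \<open>u'\<close> has a continuous right side in the
  interior, so \<open>b u'\<close> is continuous there and its indefinite integral can be
  differentiated at every point.\<close>

lemma quasi_derivative: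
  assumes x: "0 < x" "x < 1"
  shows "(quasi has_real_derivative - (b x * (quasi x + b x * u x))) (at x)"
proof -
  define s t where "s = x / 2" and "t = (x + 1) / 2"
  have st: "0 < s" "s < x" "x < t" "t < 1" using x by (auto simp: s_def t_def)
  let ?f = "\<lambda>t. b t * u' t"
  have "continuous_on {s..t} (\<lambda>y. b y * (quasi y + b y * u y))"
    using st by (intro continuous_intros quasi_continuous continuous_on_subset[OF b] continuous_on_subset[OF u_continuous]) auto
  then have "continuous_on {s..t} ?f"
    by (rule continuous_on_eq) (use st u'_eq in auto)
  then have "((\<lambda>y. integral {s..y} ?f) has_real_derivative ?f x) (at x within {s..t})"
    using st by (intro integral_has_real_derivative) auto
  then have "((\<lambda>y. quasi s - integral {s..y} ?f) has_real_derivative - ?f x) (at x within {s..t})"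
    by (auto intro!: derivative_eq_intros)
  then have "(quasi has_real_derivative - ?f x) (at x within {s..t})"
    by (rule has_field_derivative_transform_within[of _ _ _ _ 1]) (use st quasi_increment[of s] in force)+
  moreover have "at x within {s..t} = at x" using st by (simp add: at_within_Icc_at)
  ultimately show ?thesis using u'_eq[OF x] by simp
qed

text \<open>The definition of \<open>quasi\<close> is under control only in the open interval. With
  the integrating factor \<open>exp \<beta>\<close> the equation reads
  \<open>(quasi * exp \<beta>)' = - \<rho>\<close>, where \<open>\<rho>\<close> contains no
  derivative of \<open>u\<close> and is continuous on the closed interval. Solving for
  \<open>quasi\<close> gives a function \<open>w\<close> that satisfies the system up to the
  endpoints.\<close>

lemma quasi_derivative_system:
  obtains w where
    "\<And>x. x \<in> {0..1} \<Longrightarrow> (u has_real_derivative (w x + b x * u x)) (at x within {0..1})"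
    "\<And>x. x \<in> {0..1} \<Longrightarrow> (w has_real_derivative - (b x * (w x + b x * u x))) (at x within {0..1})"
proof -
  define \<beta> where "\<beta> = (\<lambda>x. integral {0..x} b)"
  have d\<beta>: "(\<beta> has_real_derivative b x) (at x within {0..1})" if "x \<in> {0..1}" for x
    unfolding \<beta>_def using b that by (rule integral_has_real_derivative)
  then have c\<beta>: "continuous_on {0..1} \<beta>" by (rule DERIV_continuous_on)
  define \<rho> where "\<rho> = (\<lambda>x. (b x)\<^sup>2 * u x * exp (\<beta> x))"
  have c\<rho>: "continuous_on {0..1} \<rho>" unfolding \<rho>_def by (intro continuous_intros b u_continuous c\<beta>)
  define R where "R = (\<lambda>x. integral {0..x} \<rho>)"
  have dR: "(R has_real_derivative \<rho> x) (at x within {0..1})" if "x \<in> {0..1}" for x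
    unfolding R_def using c\<rho> that by (rule integral_has_real_derivative)
  have at: "at x within {0..1} = at x" if "0 < x" "x < 1" for x :: real
    using that by (rule at_within_Icc_at)
  define \<kappa> where "\<kappa> = quasi (1/2) * exp (\<beta> (1/2)) + R (1/2)"
  have const: "quasi x * exp (\<beta> x) + R x = \<kappa>" if "x \<in> {0<..<1}" for x
  proof -
    have "((\<lambda>x. quasi x * exp (\<beta> x) + R x) has_real_derivative 0) (at y within {0<..<1})"
      if y: "y \<in> {0<..<1}" for y
    proof -
      have "((\<lambda>x. quasi x * exp (\<beta> x) + R x) has_real_derivative
          - (b y * (quasi y + b y * u y)) * exp (\<beta> y) + exp (\<beta> y) * b y * quasi y + \<rho> y) (at y)"
        using quasi_derivative[of y] d\<beta>[of y] dR[of y] y at[of y]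
        by (auto intro!: derivative_eq_intros)
      moreover have "- (b y * (quasi y + b y * u y)) * exp (\<beta> y) + exp (\<beta> y) * b y * quasi y + \<rho> y = 0"
        by (simp add: \<rho>_def algebra_simps power2_eq_square)
      ultimately show ?thesis by (metis has_field_derivative_at_within)
    qed
    then obtain k where "\<And>y. y \<in> {0<..<1} \<Longrightarrow> quasi y * exp (\<beta> y) + R y = k"
      using has_field_derivative_zero_constant[of "{0<..<1::real}" "\<lambda>x. quasi x * exp (\<beta> x) + R x"] by auto
    then show ?thesis using that unfolding \<kappa>_def by simp
  qed
  define w where "w = (\<lambda>x. (\<kappa> - R x) * exp (- \<beta> x))"
  have dw: "(w has_real_derivative - (b x * (w x + b x * u x))) (at x within {0..1})" if "x \<in> {0..1}" for x
  proof -
    have "(w has_real_derivative - \<rho> x * exp (- \<beta> x) + exp (- \<beta> x) * - b x * (\<kappa> - R x)) (at x within {0..1})"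
      unfolding w_def using d\<beta>[OF that] dR[OF that] by (auto intro!: derivative_eq_intros)
    moreover have "- \<rho> x * exp (- \<beta> x) + exp (- \<beta> x) * - b x * (\<kappa> - R x) = - (b x * (w x + b x * u x))"
      by (simp add: \<rho>_def w_def algebra_simps power2_eq_square exp_minus)
    ultimately show ?thesis by simp
  qed
  have wq: "w x = quasi x" if "x \<in> {0<..<1}" for x
    using const[OF that, symmetric] by (simp add: w_def exp_minus)
  have "continuous_on {0..1} w" using dw by (rule DERIV_continuous_on)
  then have c: "continuous_on {0..1} (\<lambda>x. w x + b x * u x)" by (intro continuous_intros b u_continuous)
  \<comment> \<open>\<open>u - U\<close> is continuous with zero derivative inside, hence constant;
    as \<open>U\<close> has the required one-sided derivatives at 0 and 1, so does
    \<open>u\<close>.\<close>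
  define U where "U = (\<lambda>x. integral {0..x} (\<lambda>x. w x + b x * u x))"
  have dU: "(U has_real_derivative (w x + b x * u x)) (at x within {0..1})" if "x \<in> {0..1}" for x
    unfolding U_def using c that by (rule integral_has_real_derivative)
  have eq: "u x - U x = u 0" if "x \<in> {0..1}" for x
  proof (cases "x = 0")
    case False
    then have x: "0 < x" "x \<le> 1" using that by auto
    have "u x - U x = u 0 - U 0"
    proof (rule DERIV_isconst2[of 0 1 "\<lambda>x. u x - U x"])
      show "continuous_on {0..1} (\<lambda>x. u x - U x)"
        using DERIV_continuous_on[OF dU] u_continuous by (intro continuous_on_diff) auto
      fix y :: real assume y: "0 < y" "y < 1"
      then have "((\<lambda>x. u x - U x) has_real_derivative (u' y - (w y + b y * u y))) (at y within {0..1})"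
        using u[of y] dU[of y] by (intro derivative_intros) auto
      then show "((\<lambda>x. u x - U x) has_real_derivative 0) (at y)"
        using u'_eq[OF y] wq[of y] y at[OF y] by simp
    qed (use x in auto)
    then show ?thesis by (simp add: U_def)
  qed (simp add: U_def)
  have "(u has_real_derivative (w x + b x * u x)) (at x within {0..1})" if x: "x \<in> {0..1}" for x
  proof (rule has_field_derivative_transform_within[of _ _ _ _ 1])
    show "((\<lambda>x. u 0 + U x) has_real_derivative (w x + b x * u x)) (at x within {0..1})"
      using dU[OF x] by (auto intro!: derivative_eq_intros)
  qed (use x eq in \<open>force+\<close>)
  then show thesis using dw that by blast
qed

end

section \<open>The form and the Green operator\<close>

lemma LINT_continuous:
  fixes f :: "real \<Rightarrow> real"
  assumes "continuous_on {a..b} f"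
  shows "(LINT x:{a..b}|lebesgue. f x) = integral {a..b} f"
  by (rule set_lebesgue_integral_eq_integral(2)) (rule absolutely_integrable_continuous_real[OF assms])

lemma mem_H1_D:
  assumes "h \<in> H1"
  shows "h \<in> extensional {0..1}" "abs_continuous_on01 h" "continuous_on {0..1} h" "h 0 = 0" "h 1 = 0"
  using assms by (auto simp: H1_def H_def intro: abs_continuous_on01_continuous)

lemma mem_H1_I:
  assumes "h \<in> extensional {0..1}" "abs_continuous_on01 h" "h 0 = 0" "h 1 = 0"
  shows "h \<in> H1"
proof -
  have c: "continuous_on {0..1} h" by (rule abs_continuous_on01_continuous[OF assms(2)])
  have "h \<in> borel_measurable (lebesgue_on {0..1})"
    by (rule continuous_imp_measurable_on_sets_lebesgue[OF c]) auto
  moreover have "integrable (lebesgue_on {0..1}) (\<lambda>x. (h x)\<^sup>2)"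
    by (rule absolutely_integrable_imp_integrable)
      (auto intro!: absolutely_integrable_continuous_real continuous_intros c)
  ultimately show ?thesis using assms by (simp add: H1_def H_def)
qed

lemma form_commute: "form b f g = form b g f"
  by (simp add: form_def mult.commute add.commute)

text \<open>Almost everywhere the integrand of the form equals \<open>(w h)' + g h\<close>, and the
  integral of \<open>(w h)'\<close> vanishes because \<open>w h\<close> is absolutely continuous and
  \<open>h\<close> is zero at both ends. All products are integrable, since \<open>h'\<close> is
  integrable and is multiplied only by continuous functions.\<close>

lemma form_eq_of_quasi_derivative:
  fixes b f w g h :: "real \<Rightarrow> real"
  assumes b: "continuous_on {0..1} b" and g: "continuous_on {0..1} g"
    and f: "\<And>x. x \<in> {0..1} \<Longrightarrow> (f has_real_derivative (w x + b x * f x)) (at x within {0..1})"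
    and w: "\<And>x. x \<in> {0..1} \<Longrightarrow> (w has_real_derivative - (b x * (w x + b x * f x)) - g x) (at x within {0..1})"
    and h: "abs_continuous_on01 h" "h 0 = 0" "h 1 = 0"
  shows "set_integrable lebesgue {0..1} (\<lambda>x. deriv01 f x * deriv01 h x)"
    and "form b f h = (LINT x:{0..1}|lebesgue. g x * h x)"
proof -
  define \<eta> where "\<eta> = deriv01 h"
  obtain N where N: "negligible N"
    "\<And>x. x \<in> {0..1} - N \<Longrightarrow> (h has_vector_derivative \<eta> x) (at x within {0..1})"
    and \<eta>: "\<eta> absolutely_integrable_on {0..1}"
    unfolding \<eta>_def by (rule abs_continuous_on01_fundamental_theorem[OF h(1)]) blast
  have fc: "continuous_on {0..1} f" and wc: "continuous_on {0..1} w"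
    by (rule DERIV_continuous_on, erule f, rule DERIV_continuous_on, erule w)
  have hc: "continuous_on {0..1} h" by (rule abs_continuous_on01_continuous[OF h(1)])
  have prod: "(\<lambda>x. c x * \<eta> x) absolutely_integrable_on {0..1}" if "continuous_on {0..1} c" for c :: "real \<Rightarrow> real"
  proof (rule absolutely_integrable_bounded_measurable_product_real[OF _ _ _ \<eta>])
    show "c \<in> borel_measurable (lebesgue_on {0..1})"
      by (rule continuous_imp_measurable_on_sets_lebesgue[OF that]) auto
    show "bounded (c ` {0..1})"
      using that by (intro compact_imp_bounded compact_continuous_image) auto
  qed auto
  have df: "deriv01 f x = w x + b x * f x" if "x \<in> {0..1}" for x
    using f[OF that] that by (intro deriv01_eq) (auto simp: has_real_derivative_iff_has_vector_derivative)
  have i1: "(\<lambda>x. (w x + b x * f x) * \<eta> x) absolutely_integrable_on {0..1}"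
    by (intro prod continuous_intros wc b fc)
  have e1: "deriv01 f x * deriv01 h x = (w x + b x * f x) * \<eta> x" if "x \<in> {0..1}" for x
    using df[OF that] by (simp add: \<eta>_def)
  show "set_integrable lebesgue {0..1} (\<lambda>x. deriv01 f x * deriv01 h x)"
    using i1 e1 by (subst set_integrable_cong[OF refl refl, of _ _ "\<lambda>x. (w x + b x * f x) * \<eta> x"]) auto
  have i2: "(\<lambda>x. ((w x + b x * f x) * h x + f x * \<eta> x) * b x) absolutely_integrable_on {0..1}"
  proof -
    have "(\<lambda>x. (w x + b x * f x) * h x * b x + (f x * b x) * \<eta> x) absolutely_integrable_on {0..1}"
      by (intro set_integral_add(1) absolutely_integrable_continuous_real prod continuous_intros wc b fc hc)
    then show ?thesis by (simp add: algebra_simps)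
  qed
  have "form b f h = (LINT x:{0..1}|lebesgue. (w x + b x * f x) * \<eta> x)
      - (LINT x:{0..1}|lebesgue. ((w x + b x * f x) * h x + f x * \<eta> x) * b x)"
    unfolding form_def
    by (intro arg_cong2[of _ _ _ _ "(-)"] set_lebesgue_integral_cong) (auto simp: df \<eta>_def)
  also have "\<dots> = (LINT x:{0..1}|lebesgue. (w x + b x * f x) * \<eta> x - ((w x + b x * f x) * h x + f x * \<eta> x) * b x)"
    by (rule set_integral_diff(2)[OF i1 i2, symmetric])
  also have "\<dots> = integral {0..1} (\<lambda>x. (w x + b x * f x) * \<eta> x - ((w x + b x * f x) * h x + f x * \<eta> x) * b x)"
    by (rule set_lebesgue_integral_eq_integral(2)[OF set_integral_diff(1)[OF i1 i2]])
  also have "\<dots> = integral {0..1} (\<lambda>x. deriv01 (\<lambda>x. w x * h x) x + g x * h x)"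
  proof (rule integral_spike[OF N(1)])
    fix x assume x: "x \<in> {0..1} - N"
    have "(h has_real_derivative \<eta> x) (at x within {0..1})"
      using N(2)[OF x] by (simp add: has_real_derivative_iff_has_vector_derivative)
    then have "((\<lambda>x. w x * h x) has_real_derivative (- (b x * (w x + b x * f x)) - g x) * h x + \<eta> x * w x) (at x within {0..1})"
      using w[of x] x by (auto intro!: derivative_eq_intros)
    then have "deriv01 (\<lambda>x. w x * h x) x = (- (b x * (w x + b x * f x)) - g x) * h x + \<eta> x * w x"
      using x by (intro deriv01_eq) (auto simp: has_real_derivative_iff_has_vector_derivative)
    then show "deriv01 (\<lambda>x. w x * h x) x + g x * h x
        = (w x + b x * f x) * \<eta> x - ((w x + b x * f x) * h x + f x * \<eta> x) * b x"
      by (simp add: algebra_simps)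
  qed
  also have "\<dots> = integral {0..1} (\<lambda>x. g x * h x)"
  proof -
    have "abs_continuous_on01 (\<lambda>x. w x * h x)"
      by (rule abs_continuous_on01_mult_C1[OF w _ h(1)]) (auto intro!: continuous_intros b wc fc g)
    then have "deriv01 (\<lambda>x. w x * h x) absolutely_integrable_on {0..1}"
        "(LINT x:{0..1}|lebesgue. deriv01 (\<lambda>x. w x * h x) x) = w 1 * h 1 - w 0 * h 0"
      by (auto elim: abs_continuous_on01_fundamental_theorem)
    then have "deriv01 (\<lambda>x. w x * h x) integrable_on {0..1}" "integral {0..1} (deriv01 (\<lambda>x. w x * h x)) = 0"
      using set_lebesgue_integral_eq_integral[of "{0..1}" "deriv01 (\<lambda>x. w x * h x)"] h(2,3) by auto
    moreover have "(\<lambda>x. g x * h x) integrable_on {0..1}"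
      by (intro integrable_continuous_real continuous_intros g hc)
    ultimately show ?thesis by (subst integral_add) auto
  qed
  also have "\<dots> = (LINT x:{0..1}|lebesgue. g x * h x)"
    by (intro LINT_continuous[symmetric] continuous_intros g hc)
  finally show "form b f h = (LINT x:{0..1}|lebesgue. g x * h x)" .
qed

section \<open>The Wronskian and the Green operator of the two solutions\<close>

locale green =
  fixes b u v wu wv :: "real \<Rightarrow> real"
  assumes b: "continuous_on {0..1} b"
    and u: "\<And>x. x \<in> {0..1} \<Longrightarrow> (u has_real_derivative (wu x + b x * u x)) (at x within {0..1})"
    and wu: "\<And>x. x \<in> {0..1} \<Longrightarrow> (wu has_real_derivative - (b x * (wu x + b x * u x))) (at x within {0..1})"
    and v: "\<And>x. x \<in> {0..1} \<Longrightarrow> (v has_real_derivative (wv x + b x * v x)) (at x within {0..1})"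
    and wv: "\<And>x. x \<in> {0..1} \<Longrightarrow> (wv has_real_derivative - (b x * (wv x + b x * v x))) (at x within {0..1})"
    and boundary: "u 0 = 0" "u 1 = 1" "v 0 = 1" "v 1 = 0"
begin

lemma continuous_solutions [continuous_intros]:
  "continuous_on {0..1} u" "continuous_on {0..1} v" "continuous_on {0..1} wu" "continuous_on {0..1} wv"
  by (rule DERIV_continuous_on, erule u, rule DERIV_continuous_on, erule v,
      rule DERIV_continuous_on, erule wu, rule DERIV_continuous_on, erule wv)

text \<open>The system has the matrix with rows \<open>(b, 1)\<close> and
  \<open>(- b^2, - b)\<close>, whose trace is zero, so the determinant of two solutions is constant.
  It equals \<open>u' v - u v'\<close>, as the terms with \<open>b\<close> cancel.\<close>

lemma wronskian:
  assumes "x \<in> {0..1}"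
  shows "wu x * v x - u x * wv x = wu 0"
proof -
  let ?W = "\<lambda>x. wu x * v x - u x * wv x"
  have "(?W has_real_derivative 0) (at x within {0..1})" if "x \<in> {0..1}" for x
    by (rule derivative_eq_intros u[OF that] v[OF that] wu[OF that] wv[OF that] refl)+
      (simp add: algebra_simps)
  then obtain k where "\<And>y. y \<in> {0..1} \<Longrightarrow> ?W y = k"
    using has_field_derivative_zero_constant[of "{0..1::real}" ?W] by auto
  then have "?W x = ?W 0" using assms by simp
  then show ?thesis by (simp add: boundary)
qed

text \<open>Otherwise \<open>u\<close> and \<open>wu\<close> both vanish at 0. The energy
  \<open>u^2 + wu^2\<close>, damped by \<open>exp (- C * x)\<close>, is decreasing and would be zero
  at 1, where \<open>u\<close> is 1.\<close>

lemma wu_0_neq_0: "wu 0 \<noteq> 0"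
proof
  assume wu0: "wu 0 = 0"
  have "compact (b ` {0..1})" using b by (intro compact_continuous_image) auto
  then obtain M where M: "\<And>x. x \<in> {0..1} \<Longrightarrow> \<bar>b x\<bar> \<le> M"
    using compact_imp_bounded bounded_iff by (metis imageI real_norm_def)
  \<comment> \<open>Each term bounds a part of the derivative of the energy: 1 for
    \<open>2 u wu\<close>, \<open>2 M\<close> each for \<open>2 b u^2\<close> and
    \<open>- 2 b wu^2\<close>, and \<open>M^2\<close> for \<open>- 2 b^2 u wu\<close>.\<close>
  define C where "C = 1 + 4 * M + M\<^sup>2"
  let ?E = "\<lambda>x. ((u x)\<^sup>2 + (wu x)\<^sup>2) * exp (- C * x)"
  let ?E' = "\<lambda>x. (2 * u x * (wu x + b x * u x) - 2 * wu x * (b x * (wu x + b x * u x))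
      - C * ((u x)\<^sup>2 + (wu x)\<^sup>2)) * exp (- C * x)"
  have E': "(?E has_real_derivative ?E' x) (at x within {0..1})" if "x \<in> {0..1}" for x
    by (rule derivative_eq_intros u[OF that] wu[OF that] refl)+ (simp add: algebra_simps)
  have neg: "?E' x \<le> 0" if x: "x \<in> {0..1}" for x
  proof -
    have M0: "M \<ge> 0" using M[OF x] by linarith
    have sq: "(b x)\<^sup>2 \<le> M\<^sup>2" using M[OF x] by (rule abs_le_square_iff[THEN iffD1, OF order_trans[OF _ abs_ge_self]])
    have p1: "2 * \<bar>u x * wu x\<bar> \<le> (u x)\<^sup>2 + (wu x)\<^sup>2"
      using sum_squares_bound[of "\<bar>u x\<bar>" "\<bar>wu x\<bar>"] by (simp add: abs_mult)
    let ?S = "(u x)\<^sup>2 + (wu x)\<^sup>2"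
    have t1: "2 * (u x * wu x) \<le> ?S" using p1 by linarith
    have t2: "2 * (b x * (u x)\<^sup>2) \<le> 2 * (M * ?S)"
      using M[OF x] M0 by (intro mult_left_mono mult_mono) auto
    have t3: "- 2 * (b x * (wu x)\<^sup>2) \<le> 2 * (M * ?S)"
    proof -
      have "(- b x) * (wu x)\<^sup>2 \<le> M * ?S"
        using M[OF x] M0 by (intro mult_mono) auto
      then show ?thesis by simp
    qed
    have t4: "- 2 * ((b x)\<^sup>2 * (u x * wu x)) \<le> M\<^sup>2 * ?S"
    proof -
      have "(b x)\<^sup>2 * (2 * \<bar>u x * wu x\<bar>) \<le> M\<^sup>2 * ?S" using sq p1 by (intro mult_mono) auto
      moreover have "(b x)\<^sup>2 * (2 * \<bar>u x * wu x\<bar>) = 2 * ((b x)\<^sup>2 * \<bar>u x * wu x\<bar>)"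
        by (rule mult.left_commute)
      moreover have "(b x)\<^sup>2 * - (u x * wu x) \<le> (b x)\<^sup>2 * \<bar>u x * wu x\<bar>"
        by (intro mult_left_mono) auto
      then have "- ((b x)\<^sup>2 * (u x * wu x)) \<le> (b x)\<^sup>2 * \<bar>u x * wu x\<bar>"
        by (simp only: mult_minus_right)
      ultimately show ?thesis by linarith
    qed
    have "2 * u x * (wu x + b x * u x) - 2 * wu x * (b x * (wu x + b x * u x)) - C * ?S
      = 2 * (u x * wu x) + 2 * (b x * (u x)\<^sup>2) + - 2 * (b x * (wu x)\<^sup>2) + - 2 * ((b x)\<^sup>2 * (u x * wu x))
        - (?S + 2 * (M * ?S) + 2 * (M * ?S) + M\<^sup>2 * ?S)"
      by (simp add: C_def algebra_simps power2_eq_square)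
    also have "\<dots> \<le> 0" using t1 t2 t3 t4 by linarith
    finally show ?thesis by (rule mult_nonpos_nonneg) simp
  qed
  have "?E 1 \<le> ?E 0"
  proof (rule DERIV_nonpos_imp_decreasing_open[where f = ?E])
    show "continuous_on {0..1} ?E" by (rule DERIV_continuous_on, erule E')
    fix x :: real assume "0 < x" "x < 1"
    then show "\<exists>y. (?E has_real_derivative y) (at x) \<and> y \<le> 0"
      using E'[of x] neg[of x] at_within_Icc_at[of 0 x 1] by (intro exI[of _ "?E' x"]) auto
  qed simp
  then have "1 + (wu 1)\<^sup>2 \<le> 0" using boundary wu0 by (simp add: mult_le_0_iff not_le)
  then show False using zero_le_power2[of "wu 1"] by linarith
qed

lemma deriv01_solutions:
  assumes "x \<in> {0..1}"
  shows "deriv01 u x = wu x + b x * u x" "deriv01 v x = wv x + b x * v x"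
  using u[OF assms] v[OF assms] assms
  by (auto intro!: deriv01_eq simp: has_real_derivative_iff_has_vector_derivative)

lemma \<alpha>_eq: "\<alpha> u v = wu 0"
  unfolding \<alpha>_def
proof (rule the_equality)
  have *: "deriv01 u x * v x - u x * deriv01 v x = wu 0" if "x \<in> {0..1}" for x
    using wronskian[OF that] deriv01_solutions[OF that] by (simp add: algebra_simps)
  then show "\<forall>x\<in>{0..1}. wu 0 = deriv01 u x * v x - u x * deriv01 v x" by simp
  show "a = wu 0" if "\<forall>x\<in>{0..1}. a = deriv01 u x * v x - u x * deriv01 v x" for a
    using that *[of 0] by force
qed

lemma T_eq:
  assumes g: "continuous_on {0..1} g" and x: "x \<in> {0..1}"
  shows "T u v g x = (v x * integral {0..x} (\<lambda>y. u y * g y) + u x * integral {x..1} (\<lambda>y. v y * g y)) / wu 0"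
proof -
  \<comment> \<open>This form of the kernel shows its continuity across the diagonal.\<close>
  have G: "G u v x y = u (min x y) * v (max x y)" for y by (auto simp: G_def min_def max_def)
  have "continuous_on {0..1} (\<lambda>y. u (min x y))" "continuous_on {0..1} (\<lambda>y. v (max x y))"
    using x by (auto intro!: continuous_on_compose2[OF continuous_solutions(1)]
      continuous_on_compose2[OF continuous_solutions(2)] continuous_intros)
  then have c: "continuous_on {0..1} (\<lambda>y. G u v x y * g y)"
    unfolding G using g by (intro continuous_intros)
  have "(LINT y:{0..1}|lebesgue. G u v x y * g y) = integral {0..1} (\<lambda>y. G u v x y * g y)"
    by (rule LINT_continuous[OF c])
  also have "\<dots> = integral {0..x} (\<lambda>y. G u v x y * g y) + integral {x..1} (\<lambda>y. G u v x y * g y)"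
    using x c by (intro Henstock_Kurzweil_Integration.integral_combine[symmetric] integrable_continuous_real) auto
  also have "integral {0..x} (\<lambda>y. G u v x y * g y) = integral {0..x} (\<lambda>y. v x * (u y * g y))"
    by (intro integral_cong) (auto simp: G_def)
  also have "integral {x..1} (\<lambda>y. G u v x y * g y) = integral {x..1} (\<lambda>y. u x * (v y * g y))"
    by (intro integral_cong) (auto simp: G_def)
  finally show ?thesis using x by (simp add: T_def \<alpha>_eq)
qed

text \<open>Variation of constants: \<open>w\<close> has the same coefficients \<open>p\<close> and
  \<open>q\<close> as \<open>T g\<close>, with \<open>wv\<close>, \<open>wu\<close> in place of
  \<open>v\<close>, \<open>u\<close>. The derivatives of \<open>p\<close> and \<open>q\<close>
  cancel in \<open>T g\<close>; in \<open>w\<close> they leave minus the Wronskian times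
  \<open>g\<close>, divided by \<open>wu 0\<close>, which is \<open>- g\<close>.\<close>

lemma T_quasi_derivative:
  assumes g: "continuous_on {0..1} g"
  obtains w where
    "\<And>x. x \<in> {0..1} \<Longrightarrow> (T u v g has_real_derivative (w x + b x * T u v g x)) (at x within {0..1})"
    "\<And>x. x \<in> {0..1} \<Longrightarrow> (w has_real_derivative - (b x * (w x + b x * T u v g x)) - g x) (at x within {0..1})"
proof -
  define p where "p = (\<lambda>x. integral {0..x} (\<lambda>y. u y * g y))"
  define q where "q = (\<lambda>x. integral {x..1} (\<lambda>y. v y * g y))"
  have p: "(p has_real_derivative u x * g x) (at x within {0..1})" if "x \<in> {0..1}" for x
    unfolding p_def using that by (intro integral_has_real_derivative continuous_intros g)
  have q: "(q has_real_derivative - (v x * g x)) (at x within {0..1})" if "x \<in> {0..1}" for x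
    unfolding q_def using that by (intro integral_has_real_derivative' continuous_intros g)
  define w where "w = (\<lambda>x. (wv x * p x + wu x * q x) / wu 0)"
  note nz = wu_0_neq_0
  have T: "T u v g x = (v x * p x + u x * q x) / wu 0" if "x \<in> {0..1}" for x
    using T_eq[OF g that] by (simp add: p_def q_def)
  show thesis
  proof (rule that[of w])
    fix x :: real assume x: "x \<in> {0..1}"
    have "((\<lambda>x. (v x * p x + u x * q x) / wu 0) has_real_derivative (w x + b x * T u v g x)) (at x within {0..1})"
      by (rule derivative_eq_intros u[OF x] v[OF x] p[OF x] q[OF x] refl nz)+
        (use nz in \<open>simp add: T[OF x] w_def divide_simps, simp add: algebra_simps\<close>)
    then show "(T u v g has_real_derivative (w x + b x * T u v g x)) (at x within {0..1})"
      by (rule has_field_derivative_transform_within[of _ _ _ _ 1]) (use x T in auto)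
    have "((\<lambda>x. wv x * p x + wu x * q x) has_real_derivative ((- (b x * (wv x + b x * v x))) * p x + wv x * (u x * g x)
       + (- (b x * (wu x + b x * u x))) * q x + wu x * (- (v x * g x)))) (at x within {0..1})"
      by (rule derivative_eq_intros wu[OF x] wv[OF x] p[OF x] q[OF x] refl)+
        (simp add: algebra_simps)
    from DERIV_cdivide[OF this, of "wu 0"]
    have "(w has_real_derivative ((- (b x * (wv x + b x * v x))) * p x + wv x * (u x * g x)
       + (- (b x * (wu x + b x * u x))) * q x + wu x * (- (v x * g x))) / wu 0) (at x within {0..1})"
      by (simp only: w_def)
    moreover have "((- (b x * (wv x + b x * v x))) * p x + wv x * (u x * g x)
       + (- (b x * (wu x + b x * u x))) * q x + wu x * (- (v x * g x))) / wu 0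
       = - (b x * (w x + b x * T u v g x)) - (wu x * v x - u x * wv x) / wu 0 * g x"
      using nz by (simp add: T[OF x] w_def divide_simps) (simp add: algebra_simps)
    ultimately show "(w has_real_derivative - (b x * (w x + b x * T u v g x)) - g x) (at x within {0..1})"
      using wronskian[OF x] nz by simp
  qed
qed

lemma T_in_H1:
  assumes "g \<in> H1"
  shows "T u v g \<in> H1"
proof (rule mem_H1_I)
  have g: "continuous_on {0..1} g" by (rule mem_H1_D(3)[OF assms])
  obtain w where w: "\<And>x. x \<in> {0..1} \<Longrightarrow> (T u v g has_real_derivative (w x + b x * T u v g x)) (at x within {0..1})"
    "\<And>x. x \<in> {0..1} \<Longrightarrow> (w has_real_derivative - (b x * (w x + b x * T u v g x)) - g x) (at x within {0..1})"
    using T_quasi_derivative[OF g] by blast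
  show "T u v g \<in> extensional {0..1}" by (simp add: T_def)
  show "abs_continuous_on01 (T u v g)"
    by (rule abs_continuous_on01_C1[OF w(1)])
      (auto intro!: continuous_intros b DERIV_continuous_on[OF w(1)] DERIV_continuous_on[OF w(2)])
  show "T u v g 0 = 0" "T u v g 1 = 0" by (simp_all add: T_eq[OF g] boundary)
qed

lemma T_in_L_tilde:
  assumes "g \<in> H1"
  shows "(T u v g, g) \<in> L_tilde b"
proof -
  have g: "continuous_on {0..1} g" by (rule mem_H1_D(3)[OF assms])
  obtain w where w: "\<And>x. x \<in> {0..1} \<Longrightarrow> (T u v g has_real_derivative (w x + b x * T u v g x)) (at x within {0..1})"
    "\<And>x. x \<in> {0..1} \<Longrightarrow> (w has_real_derivative - (b x * (w x + b x * T u v g x)) - g x) (at x within {0..1})"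
    using T_quasi_derivative[OF g] by blast
  have "set_integrable lebesgue {0..1} (\<lambda>x. deriv01 (T u v g) x * deriv01 h x) \<and>
      form b (T u v g) h = (LINT x:{0..1}|lebesgue. g x * h x)" if "h \<in> H1" for h
    using form_eq_of_quasi_derivative[OF b g w mem_H1_D(2,4,5)[OF that]] by simp
  then show ?thesis using assms T_in_H1[OF assms] by (simp add: L_tilde_def)
qed

text \<open>Symmetry of the form makes the operator injective: it forces \<open>f - T g\<close> to be orthogonal to itself.\<close>

lemma L_tilde_imp_T:
  assumes fg: "(f, g) \<in> L_tilde b"
  shows "f = T u v g"
proof -
  have f: "f \<in> H1" and g: "g \<in> H1"
    and form_f: "\<And>h. h \<in> H1 \<Longrightarrow> form b f h = (LINT x:{0..1}|lebesgue. g x * h x)"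
    using fg by (auto simp: L_tilde_def)
  have form_T: "form b (T u v k) h = (LINT x:{0..1}|lebesgue. k x * h x)" if "k \<in> H1" "h \<in> H1" for k h
    using T_in_L_tilde[OF that(1)] that(2) by (simp add: L_tilde_def)
  let ?S = "T u v"
  note fD = mem_H1_D[OF f] and TD = mem_H1_D[OF T_in_H1[OF g]]
  define k where "k = (\<lambda>x\<in>{0..1}. f x - ?S g x)"
  have kx: "k x = f x - ?S g x" if "x \<in> {0..1}" for x using that by (simp add: k_def)
  have k: "k \<in> H1"
  proof (rule mem_H1_I)
    show "k \<in> extensional {0..1}" by (simp add: k_def)
    show "abs_continuous_on01 k"
      by (rule abs_continuous_on01_dominated[OF fD(2) TD(2), of k 1 1]) (auto simp: kx)
  qed (auto simp: kx fD TD)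
  have kc: "continuous_on {0..1} k" by (rule mem_H1_D(3)[OF k])
  have "(LINT x:{0..1}|lebesgue. k x * f x) = form b (?S k) f" by (rule form_T[OF k f, symmetric])
  also have "\<dots> = form b f (?S k)" by (rule form_commute)
  also have "\<dots> = (LINT x:{0..1}|lebesgue. g x * ?S k x)" by (rule form_f[OF T_in_H1[OF k]])
  also have "\<dots> = form b (?S g) (?S k)" by (rule form_T[OF g T_in_H1[OF k], symmetric])
  also have "\<dots> = form b (?S k) (?S g)" by (rule form_commute)
  also have "\<dots> = (LINT x:{0..1}|lebesgue. k x * ?S g x)" by (rule form_T[OF k T_in_H1[OF g]])
  finally have "integral {0..1} (\<lambda>x. k x * f x) = integral {0..1} (\<lambda>x. k x * ?S g x)"
    using kc fD(3) TD(3) by (simp add: LINT_continuous continuous_on_mult)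
  then have "integral {0..1} (\<lambda>x. k x * f x - k x * ?S g x) = 0"
    using kc fD(3) TD(3) by (subst integral_diff) (auto intro!: integrable_continuous_real continuous_on_mult)
  moreover have "integral {0..1} (\<lambda>x. k x * f x - k x * ?S g x) = integral {0..1} (\<lambda>x. (k x)\<^sup>2)"
    by (intro integral_cong) (simp add: kx power2_eq_square right_diff_distrib)
  ultimately have "\<forall>x\<in>{0..1}. (k x)\<^sup>2 = 0"
    using kc by (subst integral_eq_0_iff[symmetric]) (auto intro!: continuous_intros)
  then have "f x = ?S g x" if "x \<in> {0..1}" for x using kx[OF that] that by auto
  then show ?thesis using fD(1) TD(1) by (intro extensionalityI[of f "{0..1}"]) auto
qed

lemma Domain_L_tilde: "Domain (L_tilde b) = T u v ` H1"
proof (intro equalityI subsetI)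
  fix f assume "f \<in> Domain (L_tilde b)"
  then obtain g where fg: "(f, g) \<in> L_tilde b" by auto
  then have "g \<in> H1" by (simp add: L_tilde_def)
  with L_tilde_imp_T[OF fg] show "f \<in> T u v ` H1" by blast
next
  fix f assume "f \<in> T u v ` H1"
  then show "f \<in> Domain (L_tilde b)" using T_in_L_tilde by blast
qed

end

section \<open>Passage from the stochastic equations to single paths\<close>

lemma solves_sde_quasi_derivative:
  assumes b: "continuous_on {0..1} b"
    and diff: "u differentiable_on {0..1}"
    and eq: "\<forall>x\<in>{0..1}. \<exists>I. has_stieltjes_integral01 (\<lambda>y. K x y * u y) b I \<and> u x - (m + n * x) = - I"
  obtains w where
    "\<And>x. x \<in> {0..1} \<Longrightarrow> (u has_real_derivative (w x + b x * u x)) (at x within {0..1})"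
    "\<And>x. x \<in> {0..1} \<Longrightarrow> (w has_real_derivative - (b x * (w x + b x * u x))) (at x within {0..1})"
    "u 0 = m" "u 1 = m + n"
proof -
  have "(u has_real_derivative deriv01 u x) (at x within {0..1})" if "x \<in> {0..1}" for x
    using diff that
    by (simp add: differentiable_on_def has_real_derivative_iff_has_vector_derivative
        vector_derivative_works[symmetric])
  then interpret sde_path b u "deriv01 u" m n
    using b eq by unfold_locales auto
  show thesis
    using quasi_derivative_system u_boundary[of 0] u_boundary[of 1] that by (metis add.right_neutral mult_1_right mult_zero_right)
qed

theorem corollary10:
  fixes M :: "'a measure" and F :: "real \<Rightarrow> 'a measure" and B u v :: "real \<Rightarrow> 'a \<Rightarrow> real"
  assumes "brownian_motion01 M F B"
    and "solves_sde M B (\<lambda>x. x) u"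
    and "solves_sde M B (\<lambda>x. 1 - x) v"
  shows "AE \<omega> in M. Domain (L_tilde (\<lambda>x. B x \<omega>)) = T (\<lambda>x. u x \<omega>) (\<lambda>x. v x \<omega>) ` H1"
proof -
  have "AE \<omega> in M. continuous_on {0..1} (\<lambda>t. B t \<omega>)"
    by (rule brownian_motion01.continuous_paths[OF assms(1)])
  moreover have "AE \<omega> in M. (\<lambda>x. u x \<omega>) differentiable_on {0..1}"
    "AE \<omega> in M. (\<lambda>x. v x \<omega>) differentiable_on {0..1}"
    "AE \<omega> in M. \<forall>x\<in>{0..1}. \<exists>I.
        has_stieltjes_integral01 (\<lambda>y. K x y * u y \<omega>) (\<lambda>y. B y \<omega>) I \<and> u x \<omega> - x = - I"
    "AE \<omega> in M. \<forall>x\<in>{0..1}. \<exists>I.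
        has_stieltjes_integral01 (\<lambda>y. K x y * v y \<omega>) (\<lambda>y. B y \<omega>) I \<and> v x \<omega> - (1 - x) = - I"
    using assms(2,3) by (simp_all add: solves_sde_def)
  ultimately show ?thesis
  proof eventually_elim
    case (elim \<omega>)
    obtain wu where wu:
      "\<And>x. x \<in> {0..1} \<Longrightarrow> ((\<lambda>x. u x \<omega>) has_real_derivative (wu x + B x \<omega> * u x \<omega>)) (at x within {0..1})"
      "\<And>x. x \<in> {0..1} \<Longrightarrow> (wu has_real_derivative - (B x \<omega> * (wu x + B x \<omega> * u x \<omega>))) (at x within {0..1})"
      "u 0 \<omega> = 0" "u 1 \<omega> = 0 + 1"
      by (rule solves_sde_quasi_derivative[OF elim(1,2), of 0 1]) (use elim(4) in auto)
    obtain wv where wv: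
      "\<And>x. x \<in> {0..1} \<Longrightarrow> ((\<lambda>x. v x \<omega>) has_real_derivative (wv x + B x \<omega> * v x \<omega>)) (at x within {0..1})"
      "\<And>x. x \<in> {0..1} \<Longrightarrow> (wv has_real_derivative - (B x \<omega> * (wv x + B x \<omega> * v x \<omega>))) (at x within {0..1})"
      "v 0 \<omega> = 1" "v 1 \<omega> = 1 + - 1"
      by (rule solves_sde_quasi_derivative[OF elim(1,3), of 1 "-1"]) (use elim(5) in auto)
    interpret green "\<lambda>x. B x \<omega>" "\<lambda>x. u x \<omega>" "\<lambda>x. v x \<omega>" wu wv
      using elim(1) wu wv by unfold_locales auto
    show ?case by (rule Domain_L_tilde)
  qed
qed

end
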